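(* For every integer $n>2$ let $\mathbf X=(X_1,\dots,X_n)'$ and $\mathbf Y=(Y_1,\dots,Y_n)'$ be two independent random vectors such that $\mathbf X$ has an $n$-variate spherical distribution with $P(\mathbf X=(0,\dots,0)')=0$ and $\mathbf Y$ has any distribution with $P(\mathbf Y\in\{k(1,\dots,1)' : k\in\mathbb R\})=0$. Suppose that $E(\mathbf X)$ and $E(\mathbf Y)$ are both known. Then, for any $0<c<1$, as $n\to\infty$, $$P(\tilde r_n\ge c)=\frac{\exp\Big(-nL^*(c)-\frac14\log(1+4\lambda_c^2)+\log\frac{1+\sqrt{1+4\lambda_c^2}}{2}\Big)}{\lambda_c\,\sigma_c\sqrt{2\pi n}}\,(1+o(1)),$$ where $\lambda_c=\frac{c}{1-c^2}$ is the unique solution of $L'(\lambda)=c$, $\sigma_c>0$ with $\sigma_c^2=L''(\lambda_c)=\frac{(1-c^2)^2}{1+c^2}$, and $L^*(y)=-\frac12\log(1-y^2)$ for $-1<y<1$.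
   Context: The empirical Pearson correlation coefficient with known expectations is $$\tilde r_n=\frac{\sum_{i=1}^n(X_i-E(X_i))(Y_i-E(Y_i))}{\sqrt{\sum_{i=1}^n(X_i-E(X_i))^2\,\sum_{i=1}^n(Y_i-E(Y_i))^2}}=\frac{(\mathbf X-E(\mathbf X))'(\mathbf Y-E(\mathbf Y))}{\|\mathbf X-E(\mathbf X)\|\,\|\mathbf Y-E(\mathbf Y)\|},$$ where $\mathbf v'$ denotes the transpose of the vector $\mathbf v$. A random vector in $\mathbb R^n$ has a spherical distribution if its law is invariant under all orthogonal transformations of $\mathbb R^n$. The function $L$ is $L(\lambda)=h(r_0(\lambda))$ for $\lambda\in\mathbb R$, where $h(r)=\lambda r+\frac12\log(1-r^2)$ and $r_0(\lambda)$ is the unique root in $]-1,1[$ of $h'(r)=0$; $L^*$ is its Legendre dual, $L^*(y)=\sup_{\lambda\in\mathbb R}\{\lambda y-L(\lambda)\}$.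
   Formalization: The formal statement adds the assumption P(Y = E(Y)) = 0 for every n > 2, so that the coefficient is almost surely defined; without it, the constant vector Y = (1,2,…,n)' satisfies all stated hypotheses but makes the coefficient 0/0. *)

theory Defs
  imports "HOL-Probability.Probability"
begin

text \<open>Since the dimension varies with the sequence index, a vector of R^n is a function on
  \<open>{1..n}\<close>, extensional outside this set, and R^n carries the product Borel sigma-algebra.\<close>

definition Rn :: "nat \<Rightarrow> (nat \<Rightarrow> real) measure" where
  "Rn n = Pi\<^sub>M {1..n} (\<lambda>_. borel)"

definition orthogonal_mat :: "nat \<Rightarrow> (nat \<Rightarrow> nat \<Rightarrow> real) \<Rightarrow> bool" where
  "orthogonal_mat n A \<longleftrightarrow>
     (\<forall>i\<in>{1..n}. \<forall>j\<in>{1..n}. (\<Sum>k=1..n. A k i * A k j) = (if i = j then 1 else 0))"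

definition mat_apply :: "nat \<Rightarrow> (nat \<Rightarrow> nat \<Rightarrow> real) \<Rightarrow> (nat \<Rightarrow> real) \<Rightarrow> (nat \<Rightarrow> real)" where
  "mat_apply n A x = (\<lambda>i\<in>{1..n}. \<Sum>j=1..n. A i j * x j)"

definition spherical :: "nat \<Rightarrow> (nat \<Rightarrow> real) measure \<Rightarrow> bool" where
  "spherical n \<mu> \<longleftrightarrow> (\<forall>A. orthogonal_mat n A \<longrightarrow> distr \<mu> (Rn n) (mat_apply n A) = \<mu>)"

definition mean :: "'a measure \<Rightarrow> ('a \<Rightarrow> nat \<Rightarrow> real) \<Rightarrow> nat \<Rightarrow> real" where
  "mean M X i = (\<integral>w. X w i \<partial>M)"

definition pearson_known_means ::
  "'a measure \<Rightarrow> nat \<Rightarrow> ('a \<Rightarrow> nat \<Rightarrow> real) \<Rightarrow> ('a \<Rightarrow> nat \<Rightarrow> real) \<Rightarrow> 'a \<Rightarrow> real" where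
  "pearson_known_means M n X Y w =
     (\<Sum>i=1..n. (X w i - mean M X i) * (Y w i - mean M Y i)) /
     sqrt ((\<Sum>i=1..n. (X w i - mean M X i)\<^sup>2) * (\<Sum>i=1..n. (Y w i - mean M Y i)\<^sup>2))"

definition h :: "real \<Rightarrow> real \<Rightarrow> real" where
  "h l r = l * r + 1/2 * ln (1 - r\<^sup>2)"

definition r0 :: "real \<Rightarrow> real" where
  "r0 l = (THE r. -1 < r \<and> r < 1 \<and> deriv (h l) r = 0)"

definition L :: "real \<Rightarrow> real" where
  "L l = h l (r0 l)"

text \<open>The Legendre dual may be infinite, so it takes values in the extended reals.\<close>

definition Lstar :: "real \<Rightarrow> ereal" where
  "Lstar y = (SUP l. ereal (l * y - L l))"

lemma h_has_derivative:
  assumes "-1 < r" "r < 1"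
  shows "(h l has_real_derivative l - r / (1 - r\<^sup>2)) (at r)"
proof -
  have "r\<^sup>2 < 1" using assms by (simp add: abs_square_less_1 abs_less_iff)
  then have "((\<lambda>r. l * r + 1/2 * ln (1 - r\<^sup>2)) has_real_derivative l - r / (1 - r\<^sup>2)) (at r)"
    by (auto intro!: derivative_eq_intros simp: field_simps)
  then show ?thesis by (simp add: h_def[abs_def])
qed

text \<open>The description in the definition of \<open>r0\<close> is proper.\<close>

lemma r0_unique: "\<exists>!r. -1 < r \<and> r < 1 \<and> deriv (h l) r = 0"
proof -
  have eq: "deriv (h l) r = 0 \<longleftrightarrow> l * (1 - r\<^sup>2) = r" if "-1 < r" "r < 1" for r
  proof -
    have "r\<^sup>2 < 1" using that by (simp add: abs_square_less_1 abs_less_iff)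
    moreover have "deriv (h l) r = l - r / (1 - r\<^sup>2)"
      by (rule DERIV_imp_deriv[OF h_has_derivative[OF that]])
    moreover have "l - r / (1 - r\<^sup>2) = 0 \<longleftrightarrow> l * (1 - r\<^sup>2) = r" if "r\<^sup>2 < 1"
      using that by (auto simp: field_simps)
    ultimately show ?thesis by simp
  qed
  define s where "s = sqrt (1 + 4 * l\<^sup>2)"
  define q where "q = 2 * l / (1 + s)"
  have s2: "s\<^sup>2 = 1 + 4 * l\<^sup>2" and s1: "s \<ge> 1" by (auto simp: s_def)
  have "\<bar>2 * l\<bar> \<le> s" unfolding s_def by (rule real_le_rsqrt) (simp add: power2_eq_square)
  then have q1: "-1 < q" "q < 1" using s1 by (auto simp: q_def field_simps abs_le_iff)
  have "1 - q\<^sup>2 = ((1 + s)\<^sup>2 - 4 * l\<^sup>2) / (1 + s)\<^sup>2"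
    using s1 by (simp add: q_def power_divide power_mult_distrib diff_divide_distrib)
  also have "(1 + s)\<^sup>2 - 4 * l\<^sup>2 = 2 * (1 + s)" using s2 by (simp add: power2_eq_square algebra_simps)
  finally have "1 - q\<^sup>2 = 2 / (1 + s)"
    using s1 by (simp add: power2_eq_square mult_divide_mult_cancel_right del: distrib_left_numeral)
  then have q2: "l * (1 - q\<^sup>2) = q" by (simp add: q_def)
  show ?thesis
  proof (rule ex1I[of _ q])
    show "-1 < q \<and> q < 1 \<and> deriv (h l) q = 0" using q1 q2 eq by blast
  next
    fix r assume r: "-1 < r \<and> r < 1 \<and> deriv (h l) r = 0"
    then have r2: "l * (1 - r\<^sup>2) = r" using eq by blast
    have pos: "l * t \<ge> 0" if "-1 < t" "t < 1" "l * (1 - t\<^sup>2) = t" for t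
    proof -
      have "t\<^sup>2 < 1" using that by (simp add: abs_square_less_1 abs_less_iff)
      then have "l\<^sup>2 * (1 - t\<^sup>2) \<ge> 0" by simp
      also have "l\<^sup>2 * (1 - t\<^sup>2) = l * t" using that(3) by (metis power2_eq_square mult.assoc)
      finally show ?thesis .
    qed
    have "l * r \<ge> 0" "l * q \<ge> 0" using pos r r2 q1 q2 by blast+
    then have "1 + l * (r + q) \<noteq> 0" by (simp add: distrib_left)
    moreover have "(r - q) * (1 + l * (r + q)) = 0"
      using r2 q2 by (simp add: power2_eq_square algebra_simps)
    ultimately show "r = q" by simp
  qed
qed

end

theory Submission
  imports Defs "HOL-Real_Asymp.Real_Asymp"
begin

text \<open>A spherical \<open>X\<close> has mean zero, so by independence one may condition on \<open>Y\<close>, and by rotation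
  invariance the coefficient has the law of \<open>U = X\<^sub>1 / \<parallel>X\<parallel>\<close>. Comparing the \<open>t\<^sup>2\<close>-coefficients of
  \<open>E (U\<^sub>i + t U\<^sub>l)\<^sup>2\<^sup>k = (1 + t\<^sup>2)\<^sup>k E U\<^sub>i\<^sup>2\<^sup>k\<close> and summing over \<open>l\<close> gives a recursion for the moments of \<open>U\<close>,
  which is also satisfied by the density proportional to \<open>(1 - r\<^sup>2) powr ((n - 3) / 2)\<close> on \<open>[-1, 1]\<close>.
  Bounded laws are determined by their moments, so no integration over the sphere is needed. The
  normalising constant is asymptotically evaluated by Wallis' recursion, the tail integral by an explicit
  antiderivative.\<close>

text \<open>Given \<open>Y\<close>, the coefficient has the same conditional law for every value of
  \<open>Y\<close> other than its mean, so the law of \<open>Y\<close> drops out of the tail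
  probability altogether. The dimension enters as \<open>m = n - 3\<close>, which turns the
  half-integer exponent of the density into a natural power of a square root. The two moment
  recursions agree because integration by parts produces the factor m + k + 3 = n + k. The claimed
  formula has the shape of a saddlepoint approximation, but no exponential tilting is involved. With
  d = 1 - c^2 and e = 1 + c^2 one has sqrt (1 + 4 lambda_c^2) = e / d and lambda_c sigma_c = c /
  sqrt e, and the right-hand side without its error factor is exactly d^((n - 1) / 2) / (c sqrt (2
  pi n)). This is the contribution of the endpoint c to the tail integral, where the weight is
  largest on [c, 1], divided by the normalising constant. Hence the calculus of \<open>L\<close> and
  \<open>Lstar\<close> is independent of the probabilistic part, and the two meet only in an
  algebraic identity.\<close>

section \<open>The semicircle-power law\<close>

text \<open>The Taylor remainder of the characteristic function at order n is at most 2 |t|^n / n!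
  times the n-th absolute moment, which is at most 1 here. So the moments determine the
  characteristic function, and Levy uniqueness gives the law.\<close>

lemma real_distribution_moments_unique:
  fixes M N :: "real measure"
  assumes M: "real_distribution M" and N: "real_distribution N"
    and bM: "AE x in M. \<bar>x\<bar> \<le> 1" and bN: "AE x in N. \<bar>x\<bar> \<le> 1"
    and eq: "\<And>k::nat. (\<integral>x. x^k \<partial>M) = (\<integral>x. x^k \<partial>N)"
  shows "M = N"
proof (rule Levy_uniqueness[OF M N], rule ext)
  fix t :: real
  have lim: "(\<lambda>n. \<Sum>k\<le>n. ((\<i> * t)^k / fact k) * complex_of_real (\<integral>x. x^k \<partial>P)) \<longlonglongrightarrow> char P t"
    if P: "real_distribution P" and b: "AE x in P. \<bar>x\<bar> \<le> 1" for P
  proof -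
    interpret P: real_distribution P by fact
    have int: "integrable P (\<lambda>x. x^k)" for k :: nat
      by (rule P.integrable_const_bound[of _ 1]) (use b in \<open>auto simp: power_le_one power_abs\<close>)
    have le1: "(\<integral>x. \<bar>x\<bar>^k \<partial>P) \<le> 1" for k :: nat
    proof -
      have "(\<integral>x. \<bar>x\<bar>^k \<partial>P) \<le> (\<integral>x. 1 \<partial>P)"
      proof (rule integral_mono_AE)
        show "integrable P (\<lambda>x. \<bar>x\<bar>^k)"
          using integrable_abs[OF int[of k]] by (simp add: power_abs)
      qed (use b in \<open>auto simp: power_le_one\<close>)
      also have "\<dots> = 1" using P.prob_space by simp
      finally show ?thesis .
    qed
    have "(\<lambda>n. 2 * (\<bar>t\<bar>^n / fact n)) \<longlonglongrightarrow> 2 * 0"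
      using summable_LIMSEQ_zero[OF summable_exp[of "\<bar>t\<bar>"]]
      by (intro tendsto_mult tendsto_const) (simp add: divide_inverse mult.commute)
    then have z: "(\<lambda>n. 2 * (\<bar>t\<bar>^n / fact n)) \<longlonglongrightarrow> 0" by simp
    have "(\<lambda>n. char P t - (\<Sum>k\<le>n. ((\<i> * t)^k / fact k) * complex_of_real (\<integral>x. x^k \<partial>P))) \<longlonglongrightarrow> 0"
    proof (rule Lim_null_comparison[OF _ z], rule always_eventually, rule allI)
      fix n
      have "norm (char P t - (\<Sum>k\<le>n. ((\<i> * t)^k / fact k) * complex_of_real (\<integral>x. x^k \<partial>P)))
        \<le> (2*\<bar>t\<bar>^n / fact n) * (\<integral>x. \<bar>x\<bar>^n \<partial>P)"
        by (rule P.char_approx1[OF int])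
      also have "\<dots> \<le> (2*\<bar>t\<bar>^n / fact n) * 1"
        by (intro mult_left_mono le1) auto
      finally show "norm (char P t - (\<Sum>k\<le>n. ((\<i> * t)^k / fact k) * complex_of_real (\<integral>x. x^k \<partial>P)))
        \<le> 2 * (\<bar>t\<bar>^n / fact n)" by simp
    qed
    from tendsto_diff[OF tendsto_const[of "char P t"] this] show ?thesis by simp
  qed
  show "char M t = char N t"
    by (rule LIMSEQ_unique[OF lim[OF M bM]]) (use lim[OF N bN] in \<open>simp add: eq\<close>)
qed

section \<open>Moments of the weight by integration by parts\<close>

lemma has_derivative_semicircle_power:
  assumes "-1 < r" "r < 1"
  shows "((\<lambda>r. sqrt (1 - r\<^sup>2) ^ (m + 2)) has_real_derivative - real (m + 2) * r * sqrt (1 - r\<^sup>2) ^ m) (at r)"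
proof -
  have "r\<^sup>2 < 1" using assms by (simp add: abs_square_less_1 abs_less_iff)
  then have p: "1 - r\<^sup>2 > 0" by simp
  have "((\<lambda>r. sqrt (1 - r\<^sup>2)) has_real_derivative - r / sqrt (1 - r\<^sup>2)) (at r)"
    using p by (auto intro!: derivative_eq_intros simp: field_simps)
  from DERIV_power[OF this, of "m + 2"] show ?thesis
    by (rule DERIV_cong) (use p in \<open>simp add: algebra_simps\<close>)
qed

text \<open>In dimension n the weight (1 - r^2)^((n - 3) / 2) is needed; writing it as the power
  \<open>m = n - 3\<close> of the square root avoids \<open>powr\<close>.\<close>

definition semicircle_moment :: "nat \<Rightarrow> nat \<Rightarrow> real" where
  "semicircle_moment m k = integral {-1..1} (\<lambda>r. r ^ k * sqrt (1 - r\<^sup>2) ^ m)"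

lemma semicircle_moment_has_integral:
  "((\<lambda>r. r ^ k * sqrt (1 - r\<^sup>2) ^ m) has_integral semicircle_moment m k) {-1..1}"
  unfolding semicircle_moment_def
  by (intro integrable_integral integrable_continuous_interval continuous_intros)

lemma semicircle_moment_1: "semicircle_moment m 1 = 0"
proof -
  have "((\<lambda>r. - real (m + 2) * (r ^ 1 * sqrt (1 - r\<^sup>2) ^ m)) has_integral
      (sqrt (1 - 1\<^sup>2) ^ (m + 2) - sqrt (1 - (-1)\<^sup>2) ^ (m + 2))) {-1..1}"
  \<comment> \<open>For \<open>m = 0\<close> and beyond, the derivative rule is only available for
    |r| < 1, because the square root is not differentiable at 0; continuity suffices at the
    endpoints.\<close>
  proof (rule fundamental_theorem_of_calculus_interior)
    show "((\<lambda>r. sqrt (1 - r\<^sup>2) ^ (m + 2)) has_vector_derivative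
        - real (m + 2) * (r ^ 1 * sqrt (1 - r\<^sup>2) ^ m)) (at r)" if "r \<in> {-1<..<1}" for r
      unfolding has_real_derivative_iff_has_vector_derivative[symmetric]
      by (rule DERIV_cong[OF has_derivative_semicircle_power]) (use that in auto)
  qed (auto intro!: continuous_intros)
  from has_integral_unique[OF this has_integral_mult_right[OF semicircle_moment_has_integral]]
  show ?thesis by simp
qed

text \<open>Integrate the derivative of r^(k+1) times the weight of exponent m + 2: the boundary
  values vanish, and the factor 1 - r^2 that is split off yields both moments.\<close>

lemma semicircle_moment_rec:
  "real (k + 1) * semicircle_moment m k = real (m + k + 3) * semicircle_moment m (k + 2)"
proof -
  have "((\<lambda>r. real (k + 1) * (r ^ k * sqrt (1 - r\<^sup>2) ^ m) - real (m + k + 3) * (r ^ (k + 2) * sqrt (1 - r\<^sup>2) ^ m))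
      has_integral (sqrt (1 - 1\<^sup>2) ^ (m + 2) * 1 ^ (k + 1) - sqrt (1 - (-1)\<^sup>2) ^ (m + 2) * (-1) ^ (k + 1))) {-1..1}"
  proof (rule fundamental_theorem_of_calculus_interior)
    fix r :: real assume r: "r \<in> {-1<..<1}"
    then have "r\<^sup>2 \<le> 1" by (simp add: abs_square_le_1 abs_le_iff)
    then have sq: "sqrt (1 - r\<^sup>2) ^ (m + 2) = sqrt (1 - r\<^sup>2) ^ m * (1 - r\<^sup>2)"
      by (simp add: power_add)
    have alg: "s * (1 - r\<^sup>2) * (real (k + 1) * r ^ k) + (- real (m + 2) * r * s) * r ^ (k + 1) =
      real (k + 1) * (r ^ k * s) - real (m + k + 3) * (r ^ (k + 2) * s)" for s
      by (simp add: algebra_simps power2_eq_square)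
    have "((\<lambda>r. sqrt (1 - r\<^sup>2) ^ (m + 2) * r ^ (k + 1)) has_real_derivative
      sqrt (1 - r\<^sup>2) ^ (m + 2) * (real (k + 1) * r ^ k) +
      (- real (m + 2) * r * sqrt (1 - r\<^sup>2) ^ m) * r ^ (k + 1)) (at r)"
      using r DERIV_pow[of "k + 1" r] by (intro DERIV_mult'[OF has_derivative_semicircle_power]) auto
    also have "sqrt (1 - r\<^sup>2) ^ (m + 2) * (real (k + 1) * r ^ k) +
      (- real (m + 2) * r * sqrt (1 - r\<^sup>2) ^ m) * r ^ (k + 1) =
      real (k + 1) * (r ^ k * sqrt (1 - r\<^sup>2) ^ m) - real (m + k + 3) * (r ^ (k + 2) * sqrt (1 - r\<^sup>2) ^ m)"
      unfolding sq by (rule alg)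
    finally show "((\<lambda>r. sqrt (1 - r\<^sup>2) ^ (m + 2) * r ^ (k + 1)) has_vector_derivative
      real (k + 1) * (r ^ k * sqrt (1 - r\<^sup>2) ^ m) - real (m + k + 3) * (r ^ (k + 2) * sqrt (1 - r\<^sup>2) ^ m)) (at r)"
      unfolding has_real_derivative_iff_has_vector_derivative .
  qed (auto intro!: continuous_intros)
  moreover have "((\<lambda>r. real (k + 1) * (r ^ k * sqrt (1 - r\<^sup>2) ^ m) - real (m + k + 3) * (r ^ (k + 2) * sqrt (1 - r\<^sup>2) ^ m))
      has_integral real (k + 1) * semicircle_moment m k - real (m + k + 3) * semicircle_moment m (k + 2)) {-1..1}"
    by (intro has_integral_diff has_integral_mult_right semicircle_moment_has_integral)
  ultimately have "sqrt (1 - 1\<^sup>2) ^ (m + 2) * 1 ^ (k + 1) - sqrt (1 - (-1)\<^sup>2) ^ (m + 2) * (-1) ^ (k + 1)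
      = real (k + 1) * semicircle_moment m k - real (m + k + 3) * semicircle_moment m (k + 2)"
    by (rule has_integral_unique)
  then show ?thesis by simp
qed

section \<open>Wallis recursion for the normalising constant\<close>

definition semicircle_mass :: "nat \<Rightarrow> real" where
  "semicircle_mass m = integral {-1..1} (\<lambda>r. sqrt (1 - r\<^sup>2) ^ m)"

lemma semicircle_mass_moment: "semicircle_mass m = semicircle_moment m 0"
  by (simp add: semicircle_mass_def semicircle_moment_def)

text \<open>Splitting off 1 - r^2 from the weight gives the mass minus the second moment, and the
  moment recursion at k = 0 makes the second moment the mass divided by m + 3.\<close>

lemma semicircle_mass_rec: "real (m + 3) * semicircle_mass (m + 2) = real (m + 2) * semicircle_mass m"
proof -
  have "((\<lambda>r. r ^ 0 * sqrt (1 - r\<^sup>2) ^ m - r ^ 2 * sqrt (1 - r\<^sup>2) ^ m) has_integral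
     semicircle_moment m 0 - semicircle_moment m 2) {-1..1}"
    by (intro has_integral_diff semicircle_moment_has_integral)
  moreover have "((\<lambda>r. r ^ 0 * sqrt (1 - r\<^sup>2) ^ m - r ^ 2 * sqrt (1 - r\<^sup>2) ^ m) has_integral
     semicircle_moment (m + 2) 0) {-1..1}"
  proof (rule has_integral_eq[OF _ semicircle_moment_has_integral])
    fix r :: real assume "r \<in> {-1..1}"
    then have "r\<^sup>2 \<le> 1" by (simp add: abs_square_le_1 abs_le_iff)
    then have "sqrt (1 - r\<^sup>2) ^ (m + 2) = sqrt (1 - r\<^sup>2) ^ m * (1 - r\<^sup>2)"
      by (simp add: power_add)
    then show "r ^ 0 * sqrt (1 - r\<^sup>2) ^ (m + 2) = r ^ 0 * sqrt (1 - r\<^sup>2) ^ m - r ^ 2 * sqrt (1 - r\<^sup>2) ^ m"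
      by (simp only: right_diff_distrib) simp
  qed
  ultimately have "semicircle_mass (m + 2) = semicircle_mass m - semicircle_moment m 2"
    unfolding semicircle_mass_moment using has_integral_unique by blast
  moreover have "semicircle_mass m = real (m + 3) * semicircle_moment m 2"
    using semicircle_moment_rec[of 0 m] by (simp add: semicircle_mass_moment numeral_2_eq_2)
  ultimately show ?thesis by (simp add: algebra_simps)
qed

lemma semicircle_mass_antimono: "semicircle_mass (Suc m) \<le> semicircle_mass m"
  unfolding semicircle_mass_def
proof (rule integral_le)
  fix r :: real assume "r \<in> {-1..1}"
  then have "r\<^sup>2 \<le> 1" by (simp add: abs_square_le_1 abs_le_iff)
  then show "sqrt (1 - r\<^sup>2) ^ Suc m \<le> sqrt (1 - r\<^sup>2) ^ m"
    by (intro power_decreasing) auto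
qed (auto intro!: integrable_continuous_interval continuous_intros)

lemma semicircle_mass_0: "semicircle_mass 0 = 2"
  by (simp add: semicircle_mass_def)

lemma semicircle_mass_1: "semicircle_mass 1 = pi / 2"
proof -
  \<comment> \<open>The value is the area of the unit half disc; the antiderivative is (r sqrt (1 -
    r^2) + arcsin r) / 2.\<close>
  have "((\<lambda>r. sqrt (1 - r\<^sup>2)) has_integral
     ((1 * sqrt (1 - 1\<^sup>2) + arcsin 1) / 2 - ((-1) * sqrt (1 - (-1)\<^sup>2) + arcsin (-1)) / 2)) {-1..1}"
  proof (rule fundamental_theorem_of_calculus_interior)
    fix r :: real assume r: "r \<in> {-1<..<1}"
    then have "r\<^sup>2 < 1" by (simp add: abs_square_less_1 abs_less_iff)
    then have p: "sqrt (1 - r\<^sup>2) > 0" "(sqrt (1 - r\<^sup>2))\<^sup>2 = 1 - r\<^sup>2" by auto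
    have "((\<lambda>r. (r * sqrt (1 - r\<^sup>2) + arcsin r) / 2) has_real_derivative
       (1 * sqrt (1 - r\<^sup>2) + (- (2 * r) * (inverse (sqrt (1 - r\<^sup>2)) / 2)) * r + inverse (sqrt (1 - r\<^sup>2))) / 2) (at r)"
      using p r by (auto intro!: derivative_eq_intros)
    also have "(1 * sqrt (1 - r\<^sup>2) + (- (2 * r) * (inverse (sqrt (1 - r\<^sup>2)) / 2)) * r + inverse (sqrt (1 - r\<^sup>2))) / 2
       = sqrt (1 - r\<^sup>2)"
    proof -
      define s where "s = sqrt (1 - r\<^sup>2)"
      have "(1 * s + (- (2 * r) * (inverse s / 2)) * r + inverse s) / 2 = s"
        using p unfolding s_def[symmetric] by (simp add: field_simps power2_eq_square)
      then show ?thesis by (simp add: s_def)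
    qed
    finally show "((\<lambda>r. (r * sqrt (1 - r\<^sup>2) + arcsin r) / 2) has_vector_derivative sqrt (1 - r\<^sup>2)) (at r)"
      unfolding has_real_derivative_iff_has_vector_derivative .
  qed (auto intro!: continuous_intros)
  then show ?thesis
    unfolding semicircle_mass_def by (auto dest!: integral_unique)
qed

text \<open>By the two-step recursion the left side does not change from m to m + 1, so its value is
  the one at m = 0, namely 2 * 2 * (pi / 2).\<close>

lemma semicircle_mass_mult_Suc: "real (m + 2) * (semicircle_mass m * semicircle_mass (Suc m)) = 2 * pi"
proof (induction m)
  case 0
  show ?case using semicircle_mass_0 semicircle_mass_1 by simp
next
  case (Suc m)
  have "real (Suc m + 2) * (semicircle_mass (Suc m) * semicircle_mass (Suc (Suc m)))
    = semicircle_mass (Suc m) * (real (m + 3) * semicircle_mass (m + 2))"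
    by (simp add: numeral_eq_Suc)
  also have "\<dots> = real (m + 2) * (semicircle_mass m * semicircle_mass (Suc m))"
    unfolding semicircle_mass_rec by simp
  finally show ?case using Suc by (simp only:)
qed

lemma semicircle_mass_pos: "semicircle_mass m > 0"
proof -
  have "semicircle_mass m \<ge> 0"
    unfolding semicircle_mass_def
    by (intro integral_nonneg integrable_continuous_interval continuous_intros)
      (auto simp: abs_square_le_1 abs_le_iff)
  moreover have "semicircle_mass m \<noteq> 0" using semicircle_mass_mult_Suc[of m] by auto
  ultimately show ?thesis by simp
qed

text \<open>Monotonicity in m places the square of the mass between its products with the next and
  with the previous mass. Both products are known exactly and both behave like 2 pi / m.\<close>

lemma semicircle_mass_asymp: "(\<lambda>m. sqrt (real m) * semicircle_mass m) \<longlonglongrightarrow> sqrt (2 * pi)"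
proof -
  have lo: "2 * pi * (real m / real (m + 2)) \<le> (sqrt (real m) * semicircle_mass m)\<^sup>2" for m
  proof -
    have "2 * pi / real (m + 2) = semicircle_mass m * semicircle_mass (Suc m)"
      using semicircle_mass_mult_Suc[of m] by (simp add: field_simps)
    also have "\<dots> \<le> semicircle_mass m * semicircle_mass m"
      by (intro mult_left_mono semicircle_mass_antimono less_imp_le semicircle_mass_pos)
    finally have "real m * (2 * pi / real (m + 2)) \<le> real m * (semicircle_mass m * semicircle_mass m)"
      by (intro mult_left_mono) auto
    then show ?thesis by (simp add: power_mult_distrib power2_eq_square mult_ac)
  qed
  have up: "(sqrt (real m) * semicircle_mass m)\<^sup>2 \<le> 2 * pi * (real m / real (m + 1))" if "m > 0" for m
  proof -
    obtain k where k: "m = Suc k" using \<open>m > 0\<close> by (cases m) auto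
    have "semicircle_mass m * semicircle_mass m \<le> semicircle_mass k * semicircle_mass m"
      unfolding k by (intro mult_right_mono semicircle_mass_antimono less_imp_le semicircle_mass_pos)
    also have "\<dots> = 2 * pi / real (m + 1)"
      using semicircle_mass_mult_Suc[of k] by (simp add: k field_simps)
    finally have "real m * (semicircle_mass m * semicircle_mass m) \<le> real m * (2 * pi / real (m + 1))"
      by (intro mult_left_mono) auto
    then show ?thesis by (simp add: power_mult_distrib power2_eq_square mult_ac)
  qed
  have "(\<lambda>m. (sqrt (real m) * semicircle_mass m)\<^sup>2) \<longlonglongrightarrow> 2 * pi"
  proof (rule tendsto_sandwich)
    show "\<forall>\<^sub>F m in sequentially. 2 * pi * (real m / real (m + 2)) \<le> (sqrt (real m) * semicircle_mass m)\<^sup>2"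
      using lo by auto
    show "\<forall>\<^sub>F m in sequentially. (sqrt (real m) * semicircle_mass m)\<^sup>2 \<le> 2 * pi * (real m / real (m + 1))"
      by (rule eventually_mono[OF eventually_gt_at_top[of 0]]) (rule up)
    show "(\<lambda>m. 2 * pi * (real m / real (m + 2))) \<longlonglongrightarrow> 2 * pi"
      by real_asymp
    show "(\<lambda>m. 2 * pi * (real m / real (m + 1))) \<longlonglongrightarrow> 2 * pi"
      by real_asymp
  qed
  then have "(\<lambda>m. sqrt ((sqrt (real m) * semicircle_mass m)\<^sup>2)) \<longlonglongrightarrow> sqrt (2 * pi)"
    by (rule tendsto_real_sqrt)
  then show ?thesis using semicircle_mass_pos by (simp add: less_imp_le)
qed

section \<open>Two-sided bounds for the tail integral\<close>

definition semicircle_tail :: "nat \<Rightarrow> real \<Rightarrow> real" where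
  "semicircle_tail m c = integral {c..1} (\<lambda>r. sqrt (1 - r\<^sup>2) ^ m)"

lemma semicircle_tail_has_integral:
  "((\<lambda>r. sqrt (1 - r\<^sup>2) ^ m) has_integral semicircle_tail m c) {c..1}"
  unfolding semicircle_tail_def
  by (intro integrable_integral integrable_continuous_interval continuous_intros)

text \<open>\<open>B\<close> is the Laplace approximation at the endpoint \<open>c\<close>. An
  additional factor r makes the weight an exact derivative, and replacing r by \<open>c\<close>
  costs only a relative error of order 1 / m.\<close>

lemma semicircle_tail_bounds:
  fixes c :: real and m :: nat
  assumes c: "0 < c" "c < 1"
  defines "B \<equiv> sqrt (1 - c\<^sup>2) ^ (m + 2) / (c * real (m + 2))"
  shows "semicircle_tail m c \<le> B"
    and "B \<le> semicircle_tail m c * (1 + 1 / (real (m + 2) * c\<^sup>2))"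
proof -
  have dr: "((\<lambda>r. - (sqrt (1 - r\<^sup>2) ^ (m + 2))) has_real_derivative (real (m + 2) * r * sqrt (1 - r\<^sup>2) ^ m)) (at r)"
    if "r \<in> {c<..<1}" for r
    by (rule DERIV_cong[OF DERIV_minus[OF has_derivative_semicircle_power]]) (use that c in \<open>auto simp: algebra_simps\<close>)
  have "((\<lambda>r. real (m + 2) * r * sqrt (1 - r\<^sup>2) ^ m) has_integral
      (- (sqrt (1 - 1\<^sup>2) ^ (m + 2)) - - (sqrt (1 - c\<^sup>2) ^ (m + 2)))) {c..1}"
    by (rule fundamental_theorem_of_calculus_interior)
      (use c dr in \<open>auto intro!: continuous_intros simp: has_real_derivative_iff_has_vector_derivative\<close>)
  then have "((\<lambda>r. 1 / (c * real (m + 2)) * (real (m + 2) * r * sqrt (1 - r\<^sup>2) ^ m)) has_integral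
      (1 / (c * real (m + 2)) * (sqrt (1 - c\<^sup>2) ^ (m + 2)))) {c..1}"
    by (intro has_integral_mult_right) simp
  then have *: "((\<lambda>r. 1 / (c * real (m + 2)) * (real (m + 2) * r * sqrt (1 - r\<^sup>2) ^ m)) has_integral B) {c..1}"
    by (simp add: B_def)
  have nn: "0 \<le> sqrt (1 - r\<^sup>2)" "0 \<le> 1 - r\<^sup>2" if "r \<in> {c..1}" for r
    using that c by (simp_all add: abs_square_le_1 abs_le_iff)
  show "semicircle_tail m c \<le> B"
  proof (rule has_integral_le[OF semicircle_tail_has_integral *])
    fix r assume r: "r \<in> {c..1}"
    \<comment> \<open>Upper bound: multiplying by r / c, which is at least 1, makes the integrand
      exactly integrable.\<close>
    have "1 * sqrt (1 - r\<^sup>2) ^ m \<le> (r / c) * sqrt (1 - r\<^sup>2) ^ m"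
      using r c nn[OF r] by (intro mult_right_mono) (auto simp: field_simps)
    moreover have "1 / (c * a) * (a * r * s) = (r / c) * s" if "a > 0" for a s :: real
      using that c by (simp add: field_simps)
    ultimately show "sqrt (1 - r\<^sup>2) ^ m \<le> 1 / (c * real (m + 2)) * (real (m + 2) * r * sqrt (1 - r\<^sup>2) ^ m)"
      by simp
  qed
  \<comment> \<open>Lower bound: dividing the antiderivative by r reproduces the weight itself plus
    a term of relative size at most 1 / ((m + 2) c^2).\<close>
  have **: "((\<lambda>r. sqrt (1 - r\<^sup>2) ^ m + sqrt (1 - r\<^sup>2) ^ (m + 2) / (real (m + 2) * r\<^sup>2)) has_integral
      (- (sqrt (1 - 1\<^sup>2) ^ (m + 2)) / (real (m + 2) * 1) - - (sqrt (1 - c\<^sup>2) ^ (m + 2)) / (real (m + 2) * c))) {c..1}"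
  proof (rule fundamental_theorem_of_calculus_interior)
    fix r assume r: "r \<in> {c<..<1}"
    then have r0: "r > 0" using c by auto
    have "((\<lambda>r. - (sqrt (1 - r\<^sup>2) ^ (m + 2)) / (real (m + 2) * r)) has_real_derivative
       ((real (m + 2) * r * sqrt (1 - r\<^sup>2) ^ m) * (real (m + 2) * r) - - (sqrt (1 - r\<^sup>2) ^ (m + 2)) * real (m + 2))
        / ((real (m + 2) * r) * (real (m + 2) * r))) (at r)"
      by (rule DERIV_divide[OF dr[OF r]]) (use r0 in \<open>auto intro!: derivative_eq_intros\<close>)
    also have "((real (m + 2) * r * sqrt (1 - r\<^sup>2) ^ m) * (real (m + 2) * r) - - (sqrt (1 - r\<^sup>2) ^ (m + 2)) * real (m + 2))
        / ((real (m + 2) * r) * (real (m + 2) * r)) =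
        sqrt (1 - r\<^sup>2) ^ m + sqrt (1 - r\<^sup>2) ^ (m + 2) / (real (m + 2) * r\<^sup>2)"
    proof -
      have "((a * r * s) * (a * r) - - q * a) / ((a * r) * (a * r)) = s + q / (a * r\<^sup>2)" if "a > 0" for a s q :: real
        using r0 that by (simp add: field_simps power2_eq_square)
      then show ?thesis by simp
    qed
    finally show "((\<lambda>r. - (sqrt (1 - r\<^sup>2) ^ (m + 2)) / (real (m + 2) * r)) has_vector_derivative
       sqrt (1 - r\<^sup>2) ^ m + sqrt (1 - r\<^sup>2) ^ (m + 2) / (real (m + 2) * r\<^sup>2)) (at r)"
      unfolding has_real_derivative_iff_has_vector_derivative .
  qed (use c in \<open>auto intro!: continuous_intros\<close>)
  show "B \<le> semicircle_tail m c * (1 + 1 / (real (m + 2) * c\<^sup>2))"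
  proof (rule has_integral_le)
    show "((\<lambda>r. sqrt (1 - r\<^sup>2) ^ m + sqrt (1 - r\<^sup>2) ^ (m + 2) / (real (m + 2) * r\<^sup>2)) has_integral B) {c..1}"
      using ** by (simp add: B_def mult.commute)
    show "((\<lambda>r. sqrt (1 - r\<^sup>2) ^ m * (1 + 1 / (real (m + 2) * c\<^sup>2))) has_integral
       semicircle_tail m c * (1 + 1 / (real (m + 2) * c\<^sup>2))) {c..1}"
      by (intro has_integral_mult_left semicircle_tail_has_integral)
    fix r assume r: "r \<in> {c..1}"
    have "sqrt (1 - r\<^sup>2) ^ (m + 2) / (real (m + 2) * r\<^sup>2) \<le> sqrt (1 - r\<^sup>2) ^ m / (real (m + 2) * c\<^sup>2)"
    proof (rule frac_le)
      show "sqrt (1 - r\<^sup>2) ^ (m + 2) \<le> sqrt (1 - r\<^sup>2) ^ m"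
        using nn[OF r] by (intro power_decreasing) auto
      show "real (m + 2) * c\<^sup>2 \<le> real (m + 2) * r\<^sup>2"
        using r c by (intro mult_left_mono power_mono) auto
    qed (use nn[OF r] c in auto)
    then show "sqrt (1 - r\<^sup>2) ^ m + sqrt (1 - r\<^sup>2) ^ (m + 2) / (real (m + 2) * r\<^sup>2)
       \<le> sqrt (1 - r\<^sup>2) ^ m * (1 + 1 / (real (m + 2) * c\<^sup>2))"
      by (simp add: distrib_left)
  qed
qed

lemma semicircle_tail_asymp:
  assumes c: "0 < c" "c < 1"
  shows "(\<lambda>m. semicircle_tail m c / (sqrt (1 - c\<^sup>2) ^ (m + 2) / (c * real (m + 2)))) \<longlonglongrightarrow> 1"
proof (rule tendsto_sandwich)
  have "c\<^sup>2 < 1" using c by (simp add: abs_square_less_1 abs_less_iff)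
  then have p: "sqrt (1 - c\<^sup>2) ^ (m + 2) / (c * real (m + 2)) > 0" for m
    using c by (intro divide_pos_pos zero_less_power mult_pos_pos) auto
  have q: "1 + 1 / (real (m + 2) * c\<^sup>2) > 0" for m
    using c by (intro add_pos_pos divide_pos_pos mult_pos_pos) auto
  show "\<forall>\<^sub>F m in sequentially. 1 / (1 + 1 / (real (m + 2) * c\<^sup>2)) \<le>
     semicircle_tail m c / (sqrt (1 - c\<^sup>2) ^ (m + 2) / (c * real (m + 2)))"
  proof (rule always_eventually, rule allI)
    fix m
    have "\<And>a t x :: real. a > 0 \<Longrightarrow> x > 0 \<Longrightarrow> a \<le> t * x \<Longrightarrow> 1 / x \<le> t / a"
      by (simp add: field_simps)
    then show "1 / (1 + 1 / (real (m + 2) * c\<^sup>2)) \<le>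
     semicircle_tail m c / (sqrt (1 - c\<^sup>2) ^ (m + 2) / (c * real (m + 2)))"
      using p[of m] q[of m] semicircle_tail_bounds(2)[OF c, of m] by blast
  qed
  show "\<forall>\<^sub>F m in sequentially. semicircle_tail m c / (sqrt (1 - c\<^sup>2) ^ (m + 2) / (c * real (m + 2))) \<le> 1"
    using semicircle_tail_bounds(1)[OF c] p by (intro always_eventually allI) (simp only: divide_le_eq_1_pos)
  show "(\<lambda>m. 1 / (1 + 1 / (real (m + 2) * c\<^sup>2))) \<longlonglongrightarrow> 1"
    using c by real_asymp
qed simp

section \<open>Spherical distributions\<close>

definition dot :: "nat \<Rightarrow> (nat \<Rightarrow> real) \<Rightarrow> (nat \<Rightarrow> real) \<Rightarrow> real" where
  "dot n x y = (\<Sum>i=1..n. x i * y i)"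

lemma dot_commute: "dot n x y = dot n y x"
  by (simp add: dot_def mult.commute)

lemma dot_add_right: "dot n x (\<lambda>i. y i + z i) = dot n x y + dot n x z"
  by (simp add: dot_def distrib_left sum.distrib)

lemma dot_diff_right: "dot n x (\<lambda>i. y i - z i) = dot n x y - dot n x z"
  by (simp add: dot_def right_diff_distrib sum_subtractf)

lemma dot_scale_right: "dot n x (\<lambda>i. a * y i) = a * dot n x y"
  by (simp add: dot_def sum_distrib_left mult_ac)

lemma dot_nonneg: "dot n x x \<ge> 0"
  by (simp add: dot_def sum_nonneg)

lemma dot_eq_0_iff: "dot n x x = 0 \<longleftrightarrow> (\<forall>i\<in>{1..n}. x i = 0)"
  by (simp add: dot_def sum_nonneg_eq_0_iff)

lemma dot_zero_left: "dot n w w = 0 \<Longrightarrow> dot n w x = 0"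
  unfolding dot_eq_0_iff by (simp add: dot_def)

lemma dot_single: "i \<in> {1..n} \<Longrightarrow> dot n x (\<lambda>k. if k = i then 1 else 0) = x i"
  by (simp add: dot_def if_distrib[of "times _"] cong: if_cong)

text \<open>Cauchy-Schwarz. At a zero vector the quotient is 0 by convention, so the bound holds
  everywhere and gives integrability without exceptional sets.\<close>

lemma dot_bounded: "\<bar>dot n x v / sqrt (dot n x x)\<bar> \<le> sqrt (dot n v v)"
proof (cases "dot n x x = 0")
  case True
  then show ?thesis by (simp add: dot_nonneg)
next
  case False
  then have p: "dot n x x > 0" using dot_nonneg[of n x] by simp
  have "(dot n x v)\<^sup>2 \<le> dot n x x * dot n v v"
    unfolding dot_def using Cauchy_Schwarz_ineq_sum[of x v "{1..n}"] by (simp add: power2_eq_square)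
  then have "\<bar>dot n x v\<bar> \<le> sqrt (dot n x x) * sqrt (dot n v v)"
    by (metis real_sqrt_abs real_sqrt_le_iff real_sqrt_mult)
  then show ?thesis using p by (simp add: abs_divide divide_le_eq mult.commute)
qed

text \<open>For \<open>w = 0\<close> the convention \<open>x / 0 = 0\<close> makes this the identity matrix, so no case distinction on
  \<open>u = v\<close> is needed when reflecting along \<open>u - v\<close>.\<close>

definition householder :: "nat \<Rightarrow> (nat \<Rightarrow> real) \<Rightarrow> nat \<Rightarrow> nat \<Rightarrow> real" where
  "householder n w i j = (if i = j then 1 else 0) - 2 * w i * w j / dot n w w"

lemma orthogonal_householder: "orthogonal_mat n (householder n w)"
  unfolding orthogonal_mat_def
proof (intro ballI)
  fix i j assume i: "i \<in> {1..n}" and j: "j \<in> {1..n}"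
  define d where "d = dot n w w"
  have ij: "(if k = i then 1 else 0) * (if k = j then (1::real) else 0) = (if k = i then (if i = j then 1 else 0) else 0)" for k
    by auto
  have "(\<Sum>k=1..n. householder n w k i * householder n w k j) =
    (\<Sum>k=1..n. (if k = i then (if i = j then 1 else 0) else 0) - (if k = i then 2 * w k * w j / d else 0)
      - (if k = j then 2 * w k * w i / d else 0) + 4 * w i * w j / d\<^sup>2 * (w k * w k))"
    unfolding householder_def d_def[symmetric]
    by (intro sum.cong refl) (auto simp: algebra_simps power2_eq_square)
  also have "\<dots> = (if i = j then 1 else 0) - 2 * w i * w j / d - 2 * w j * w i / d
     + 4 * w i * w j / d\<^sup>2 * d"
    using i j unfolding sum.distrib sum_subtractf sum_distrib_left[symmetric]
    by (simp add: d_def dot_def)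
  \<comment> \<open>The three correction terms add up to zero if \<open>d\<close> is nonzero, and
    each of them is 0 by the division convention otherwise.\<close>
  also have "\<dots> = (if i = j then 1 else 0)"
    by (simp add: power2_eq_square)
  finally show "(\<Sum>k=1..n. householder n w k i * householder n w k j) = (if i = j then 1 else 0)" .
qed

lemma householder_apply:
  "i \<in> {1..n} \<Longrightarrow> mat_apply n (householder n w) x i = x i - 2 * (dot n w x / dot n w w) * w i"
proof -
  assume i: "i \<in> {1..n}"
  have "mat_apply n (householder n w) x i = (\<Sum>j=1..n. (if i = j then x j else 0) - 2 / dot n w w * w i * (w j * x j))"
    unfolding mat_apply_def householder_def using i by (auto intro!: sum.cong simp: algebra_simps)
  also have "\<dots> = x i - 2 / dot n w w * w i * dot n w x"
    using i unfolding sum_subtractf sum_distrib_left[symmetric] by (simp add: dot_def)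
  finally show ?thesis by simp
qed

lemma dot_householder_left:
  "dot n (mat_apply n (householder n w) x) y = dot n x y - 2 * (dot n w x / dot n w w) * dot n w y"
proof -
  have "dot n (mat_apply n (householder n w) x) y = dot n (\<lambda>i. x i - 2 * (dot n w x / dot n w w) * w i) y"
    unfolding dot_def[of n _ y] by (intro sum.cong refl) (simp add: householder_apply)
  also have "\<dots> = dot n y x - 2 * (dot n w x / dot n w w) * dot n y w"
    unfolding dot_commute[of n _ y] dot_diff_right dot_scale_right ..
  finally show ?thesis by (simp add: dot_commute)
qed

lemma dot_householder_self:
  "dot n (mat_apply n (householder n w) x) (mat_apply n (householder n w) x) = dot n x x"
proof -
  have "dot n w (mat_apply n (householder n w) x) = dot n w x - 2 * (dot n w x / dot n w w) * dot n w w"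
    using dot_householder_left[of n w x w] by (simp add: dot_commute)
  moreover have "dot n x (mat_apply n (householder n w) x) = dot n x x - 2 * (dot n w x / dot n w w) * dot n w x"
    using dot_householder_left[of n w x x] by (simp add: dot_commute)
  ultimately show ?thesis
    unfolding dot_householder_left[of n w x "mat_apply n (householder n w) x"]
    by (cases "dot n w w = 0") (simp_all add: field_simps)
qed

text \<open>The reflection along u - v exchanges two vectors of equal length and is symmetric, so it
  can be moved from \<open>x\<close> to \<open>u\<close>.\<close>

lemma dot_householder_swap:
  assumes "dot n u u = dot n v v"
  shows "dot n (mat_apply n (householder n (\<lambda>i. u i - v i)) x) u = dot n x v"
proof -
  define w where "w = (\<lambda>i. u i - v i)"
  \<comment> \<open>Equal lengths enter here: they make the reflection coefficient of
    \<open>u\<close> along \<open>w\<close> equal to 1. If \<open>w\<close> vanishes, both inner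
    products with \<open>x\<close> coincide.\<close>
  have ww: "dot n w w = 2 * dot n w u"
    using assms unfolding w_def dot_diff_right dot_commute[of n "\<lambda>i. u i - v i"]
    by (simp add: dot_commute)
  have wx: "dot n w x = dot n x u - dot n x v"
    unfolding w_def dot_commute[of n _ x] dot_diff_right ..
  show ?thesis
  proof (cases "dot n w w = 0")
    case True
    then show ?thesis
      using wx dot_zero_left[OF True, of x] unfolding w_def[symmetric] dot_householder_left by simp
  next
    case False
    then show ?thesis
      using wx ww unfolding w_def[symmetric] dot_householder_left by (simp add: field_simps)
  qed
qed

section \<open>Measurability and rotation invariance of laws\<close>

lemma measurable_component_Rn[measurable]: "i \<in> {1..n} \<Longrightarrow> (\<lambda>x. x i) \<in> borel_measurable (Rn n)"
  unfolding Rn_def by (rule measurable_component_singleton)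

lemma measurable_dot_Rn[measurable]:
  assumes "f \<in> measurable N (Rn n)" "g \<in> measurable N (Rn n)"
  shows "(\<lambda>x. dot n (f x) (g x)) \<in> borel_measurable N"
  unfolding dot_def
  by (intro borel_measurable_sum borel_measurable_times measurable_compose[OF assms(1)]
      measurable_compose[OF assms(2)] measurable_component_Rn)

lemma measurable_dot_const[measurable]: "(\<lambda>x. dot n x v) \<in> borel_measurable (Rn n)"
  unfolding dot_def by (intro borel_measurable_sum borel_measurable_times measurable_component_Rn) auto

lemma measurable_mat_apply: "mat_apply n A \<in> measurable (Rn n) (Rn n)"
  unfolding mat_apply_def[abs_def] by (subst (2) Rn_def) (intro measurable_restrict, simp)

text \<open>A single reflection suffices, since it carries \<open>u\<close> to \<open>v\<close> and
  keeps the norm of \<open>x\<close>. The law is taken jointly with the squared norm so that the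
  quotient of the two can be formed afterwards.\<close>

lemma spherical_distr_dot_eq:
  assumes sph: "spherical n \<mu>" and sets: "sets \<mu> = sets (Rn n)"
    and uv: "dot n u u = dot n v v"
  shows "distr \<mu> (borel \<Otimes>\<^sub>M borel) (\<lambda>x. (dot n x u, dot n x x)) =
    distr \<mu> (borel \<Otimes>\<^sub>M borel) (\<lambda>x. (dot n x v, dot n x x))"
proof -
  define A where "A = householder n (\<lambda>i. u i - v i)"
  have [measurable_cong]: "sets \<mu> = sets (Rn n)" by fact
  have inv: "distr \<mu> (Rn n) (mat_apply n A) = \<mu>"
    using sph orthogonal_householder unfolding spherical_def A_def by blast
  have "distr \<mu> (borel \<Otimes>\<^sub>M borel) (\<lambda>x. (dot n x u, dot n x x)) =
    distr (distr \<mu> (Rn n) (mat_apply n A)) (borel \<Otimes>\<^sub>M borel) (\<lambda>x. (dot n x u, dot n x x))"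
    by (simp only: inv)
  also have "\<dots> = distr \<mu> (borel \<Otimes>\<^sub>M borel) (\<lambda>x. (dot n x v, dot n x x))"
    using measurable_mat_apply[of n A]
    by (subst distr_distr) (auto simp: comp_def A_def dot_householder_swap[OF uv] dot_householder_self)
  finally show ?thesis .
qed

lemma spherical_distr_cosine_eq:
  assumes "spherical n \<mu>" and sets: "sets \<mu> = sets (Rn n)" and "dot n u u = dot n v v"
  shows "distr \<mu> borel (\<lambda>x. dot n x u / sqrt (dot n x x)) = distr \<mu> borel (\<lambda>x. dot n x v / sqrt (dot n x x))"
proof -
  have [measurable_cong]: "sets \<mu> = sets (Rn n)" by fact
  have eq: "distr \<mu> borel (\<lambda>x. dot n x w / sqrt (dot n x x)) =
    distr (distr \<mu> (borel \<Otimes>\<^sub>M borel) (\<lambda>x. (dot n x w, dot n x x))) borel (\<lambda>(a, b). a / sqrt b)" for w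
    by (subst distr_distr) (auto simp: comp_def)
  show ?thesis unfolding eq spherical_distr_dot_eq[OF assms] ..
qed

lemma coeff_one_plus_square_power:
  "coeff ([:1, 0, 1:] ^ k) 0 = (1::real)" "coeff ([:1, 0, 1:] ^ k) 1 = (0::real)"
  "coeff ([:1, 0, 1:] ^ k) 2 = real k"
  by (induction k) (auto simp: numeral_2_eq_2 coeff_mult_0)

section \<open>Moments of one normalised coordinate\<close>

context
  fixes n :: nat and \<mu> :: "(nat \<Rightarrow> real) measure"
  assumes n: "n \<ge> 1" and prob: "prob_space \<mu>" and sph: "spherical n \<mu>" and sets: "sets \<mu> = sets (Rn n)"
    and nz: "AE x in \<mu>. dot n x x \<noteq> 0"
begin

interpretation prob_space \<mu> by (rule prob)

declare sets[measurable_cong]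

definition unit_coord :: "nat \<Rightarrow> (nat \<Rightarrow> real) \<Rightarrow> real" where
  "unit_coord i x = x i / sqrt (dot n x x)"

lemma measurable_unit_coord[measurable]: "i \<in> {1..n} \<Longrightarrow> unit_coord i \<in> borel_measurable \<mu>"
proof -
  assume [measurable]: "i \<in> {1..n}"
  have "unit_coord i \<in> borel_measurable (Rn n)"
    unfolding unit_coord_def[abs_def] by measurable
  then show ?thesis by (simp add: measurable_cong_sets[OF sets refl])
qed

lemma abs_unit_coord_le: "i \<in> {1..n} \<Longrightarrow> \<bar>unit_coord i x\<bar> \<le> 1"
  using dot_bounded[of n x "\<lambda>k. if k = i then 1 else 0"] dot_single[of i n "\<lambda>k. if k = i then 1 else 0"]
  by (simp add: unit_coord_def dot_single)

lemma integrable_unit_coord: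
  assumes "i \<in> {1..n}" "l \<in> {1..n}"
  shows "integrable \<mu> (\<lambda>x. unit_coord l x ^ a * unit_coord i x ^ b)"
  using assms abs_unit_coord_le
  by (intro integrable_const_bound[of _ 1]) (auto simp: abs_mult power_abs intro!: mult_le_one power_le_one)

lemma unit_coord_moment_rotate:
  assumes "dot n u u = dot n v v"
  shows "(\<integral>x. (dot n x u / sqrt (dot n x x)) ^ d \<partial>\<mu>) = (\<integral>x. (dot n x v / sqrt (dot n x x)) ^ d \<partial>\<mu>)"
proof -
  have "(\<integral>x. (dot n x w / sqrt (dot n x x)) ^ d \<partial>\<mu>) =
    (\<integral>y. y ^ d \<partial>distr \<mu> borel (\<lambda>x. dot n x w / sqrt (dot n x x)))" for w
    by (subst integral_distr) auto
  then show ?thesis using spherical_distr_cosine_eq[OF sph sets assms] by simp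
qed

text \<open>The vectors e_i and -e_i have the same length, so the coordinate has a symmetric
  law.\<close>

lemma unit_coord_odd_moment:
  assumes "i \<in> {1..n}" "odd d"
  shows "(\<integral>x. unit_coord i x ^ d \<partial>\<mu>) = 0"
proof -
  let ?e = "\<lambda>k. if k = i then 1 else (0::real)"
  have "dot n (\<lambda>k. -1 * ?e k) (\<lambda>k. -1 * ?e k) = dot n ?e ?e" by (simp add: dot_def)
  from unit_coord_moment_rotate[OF this, of d]
  have "(\<integral>x. (- unit_coord i x) ^ d \<partial>\<mu>) = (\<integral>x. unit_coord i x ^ d \<partial>\<mu>)"
    unfolding dot_scale_right using assms by (simp add: unit_coord_def dot_single)
  then show ?thesis using assms by (simp add: power_minus_odd)
qed

text \<open>The vectors e_i + t e_l and sqrt (1 + t^2) e_i have the same length for every t. In the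
  resulting polynomial identity the t^2-coefficients carry the factors
  \<open>(2k+2) choose 2\<close> = (k + 1)(2k + 1) and k + 1.\<close>

lemma unit_coord_mixed_moment:
  assumes il: "i \<in> {1..n}" "l \<in> {1..n}" "i \<noteq> l"
  shows "real (2 * k + 1) * (\<integral>x. unit_coord l x ^ 2 * unit_coord i x ^ (2 * k) \<partial>\<mu>)
    = (\<integral>x. unit_coord i x ^ (2 * k + 2) \<partial>\<mu>)"
proof -
  define d where "d = 2 * k + 2"
  define c where "c j = real (d choose j) * (\<integral>x. unit_coord l x ^ j * unit_coord i x ^ (d - j) \<partial>\<mu>)" for j
  \<comment> \<open>\<open>p\<close> is the binomial expansion of the moment of U_i + t U_l and
    \<open>q\<close> its value by rotation; agreement at all real t makes their coefficients
    equal.\<close>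
  define p where "p = (\<Sum>j\<le>d. monom (c j) j)"
  define q where "q = smult (\<integral>x. unit_coord i x ^ d \<partial>\<mu>) ([:1, 0, 1:] ^ (k + 1))"
  have "poly p t = poly q t" for t
  proof -
    let ?e = "\<lambda>j k. if k = j then 1 else (0::real)"
    let ?u = "\<lambda>k. ?e i k + t * ?e l k" and ?v = "\<lambda>k. sqrt (1 + t\<^sup>2) * ?e i k"
    have u: "dot n x ?u = x i + t * x l" for x
      unfolding dot_add_right dot_scale_right using il by (simp add: dot_single)
    have v: "dot n x ?v = sqrt (1 + t\<^sup>2) * x i" for x
      unfolding dot_scale_right using il by (simp add: dot_single)
    have "dot n ?u ?u = dot n ?v ?v"
      unfolding u v using il by (auto simp: power2_eq_square)
    from unit_coord_moment_rotate[OF this, of d]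
    have "(\<integral>x. (t * unit_coord l x + unit_coord i x) ^ d \<partial>\<mu>) = (\<integral>x. (sqrt (1 + t\<^sup>2) * unit_coord i x) ^ d \<partial>\<mu>)"
      unfolding u v by (simp add: unit_coord_def add_divide_distrib add.commute)
    also have "\<dots> = (1 + t\<^sup>2) ^ (k + 1) * (\<integral>x. unit_coord i x ^ d \<partial>\<mu>)"
    proof -
      have "sqrt (1 + t\<^sup>2) ^ d = ((sqrt (1 + t\<^sup>2))\<^sup>2) ^ (k + 1)"
        unfolding d_def power_mult[symmetric] by (simp add: algebra_simps)
      also have "\<dots> = (1 + t\<^sup>2) ^ (k + 1)" by simp
      finally show ?thesis by (simp add: power_mult_distrib)
    qed
    also have "\<dots> = poly q t"
      by (simp add: q_def power2_eq_square algebra_simps)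
    finally have 1: "(\<integral>x. (t * unit_coord l x + unit_coord i x) ^ d \<partial>\<mu>) = poly q t" .
    have "(\<integral>x. (t * unit_coord l x + unit_coord i x) ^ d \<partial>\<mu>) =
      (\<integral>x. (\<Sum>j\<le>d. real (d choose j) * t ^ j * (unit_coord l x ^ j * unit_coord i x ^ (d - j))) \<partial>\<mu>)"
      unfolding binomial_ring by (simp add: power_mult_distrib mult_ac)
    also have "\<dots> = (\<Sum>j\<le>d. real (d choose j) * t ^ j * (\<integral>x. unit_coord l x ^ j * unit_coord i x ^ (d - j) \<partial>\<mu>))"
      using integrable_unit_coord[OF il(1,2)] by (subst Bochner_Integration.integral_sum) auto
    also have "\<dots> = poly p t"
      by (simp add: p_def c_def poly_sum poly_monom mult_ac)
    finally show ?thesis using 1 by simp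
  qed
  then have "p = q" by (simp add: poly_eq_poly_eq_iff[symmetric] fun_eq_iff)
  then have "coeff p 2 = coeff q 2" by simp
  moreover have "coeff p 2 = c 2" by (simp add: p_def coeff_sum) (simp add: d_def)
  moreover have "coeff q 2 = real (k + 1) * (\<integral>x. unit_coord i x ^ d \<partial>\<mu>)"
    unfolding q_def coeff_smult coeff_one_plus_square_power by simp
  moreover have "real (d choose 2) = real (k + 1) * real (2 * k + 1)"
  proof -
    have "d choose 2 = (k + 1) * (2 * k + 1)" unfolding choose_two by (simp add: d_def)
    then show ?thesis by (simp only: of_nat_mult)
  qed
  ultimately have "real (k + 1) * (real (2 * k + 1) * (\<integral>x. unit_coord l x ^ 2 * unit_coord i x ^ (2 * k) \<partial>\<mu>))
    = real (k + 1) * (\<integral>x. unit_coord i x ^ d \<partial>\<mu>)"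
    by (simp add: c_def d_def)
  then show ?thesis by (simp add: d_def)
qed

text \<open>For even j, insert 1 = sum of the U_l^2. The term l = i is the next even moment, and
  each of the other n - 1 terms is that moment divided by j + 1. For odd j both sides
  vanish.\<close>

lemma unit_coord_moment_rec:
  assumes i: "i \<in> {1..n}"
  shows "real (j + 1) * (\<integral>x. unit_coord i x ^ j \<partial>\<mu>) = real (n + j) * (\<integral>x. unit_coord i x ^ (j + 2) \<partial>\<mu>)"
proof (cases "even j")
  case False
  then show ?thesis using i unit_coord_odd_moment[of i "j + 2"] by (simp add: unit_coord_odd_moment)
next
  case True
  then obtain k where k: "j = 2 * k" by (auto elim: evenE)
  define m where "m = (\<integral>x. unit_coord i x ^ (2 * k + 2) \<partial>\<mu>)"
  have one: "(\<Sum>l=1..n. unit_coord l x ^ 2) = 1" if "dot n x x \<noteq> 0" for x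
  proof -
    have "(\<Sum>l=1..n. unit_coord l x ^ 2) = (\<Sum>l=1..n. x l * x l) / dot n x x"
      unfolding unit_coord_def sum_divide_distrib
      by (intro sum.cong refl) (simp add: power_divide dot_nonneg power2_eq_square[of "x _"])
    then show ?thesis using that by (simp add: dot_def)
  qed
  have "(\<integral>x. unit_coord i x ^ (2 * k) \<partial>\<mu>) = (\<integral>x. (\<Sum>l=1..n. unit_coord l x ^ 2 * unit_coord i x ^ (2 * k)) \<partial>\<mu>)"
  proof (rule integral_cong_AE)
    \<comment> \<open>The squares sum to 1 only off the origin, where division by the norm is
      genuine.\<close>
    show "AE x in \<mu>. unit_coord i x ^ (2 * k) = (\<Sum>l=1..n. unit_coord l x ^ 2 * unit_coord i x ^ (2 * k))"
      using nz by eventually_elim (metis one mult_1 sum_distrib_right)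
  qed (use i in auto)
  also have "\<dots> = (\<Sum>l=1..n. \<integral>x. unit_coord l x ^ 2 * unit_coord i x ^ (2 * k) \<partial>\<mu>)"
    using integrable_unit_coord i by (intro Bochner_Integration.integral_sum) auto
  also have "\<dots> = (\<integral>x. unit_coord i x ^ 2 * unit_coord i x ^ (2 * k) \<partial>\<mu>) +
      (\<Sum>l\<in>{1..n}-{i}. \<integral>x. unit_coord l x ^ 2 * unit_coord i x ^ (2 * k) \<partial>\<mu>)"
    using i by (intro sum.remove) auto
  also have "(\<integral>x. unit_coord i x ^ 2 * unit_coord i x ^ (2 * k) \<partial>\<mu>) = m"
    by (simp add: m_def power_add[symmetric] add.commute)
  also have "(\<Sum>l\<in>{1..n}-{i}. \<integral>x. unit_coord l x ^ 2 * unit_coord i x ^ (2 * k) \<partial>\<mu>) =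
     (\<Sum>l\<in>{1..n}-{i}. m / real (2 * k + 1))"
  proof (intro sum.cong refl)
    fix l assume "l \<in> {1..n} - {i}"
    then have "real (2 * k + 1) * (\<integral>x. unit_coord l x ^ 2 * unit_coord i x ^ (2 * k) \<partial>\<mu>) = m"
      unfolding m_def using i by (intro unit_coord_mixed_moment) auto
    then show "(\<integral>x. unit_coord l x ^ 2 * unit_coord i x ^ (2 * k) \<partial>\<mu>) = m / real (2 * k + 1)"
      by (simp add: eq_divide_eq mult.commute del: of_nat_add of_nat_mult)
  qed
  also have "\<dots> = (real n - 1) * (m / real (2 * k + 1))"
    using i n by simp
  finally have "(\<integral>x. unit_coord i x ^ (2 * k) \<partial>\<mu>) = m + (real n - 1) * (m / real (2 * k + 1))" .
  then have "real (2 * k + 1) * (\<integral>x. unit_coord i x ^ (2 * k) \<partial>\<mu>) = real (n + 2 * k) * m"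
    by (simp add: field_simps)
  then show ?thesis by (simp add: k m_def)
qed

end

section \<open>The functions L and Lstar\<close>

lemma r0_properties: "-1 < r0 l" "r0 l < 1" "l * (1 - (r0 l)\<^sup>2) = r0 l"
proof -
  have r: "-1 < r0 l \<and> r0 l < 1 \<and> deriv (h l) (r0 l) = 0"
    unfolding r0_def by (rule theI'[OF r0_unique])
  then show "-1 < r0 l" "r0 l < 1" by auto
  then have "l - r0 l / (1 - (r0 l)\<^sup>2) = 0" "(r0 l)\<^sup>2 < 1"
    using r DERIV_imp_deriv[OF h_has_derivative[of "r0 l" l]] by (auto simp: abs_square_less_1 abs_less_iff)
  then show "l * (1 - (r0 l)\<^sup>2) = r0 l" by (simp add: field_simps)
qed

lemma r0_square_less_1: "(r0 l)\<^sup>2 < 1"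
  using r0_properties[of l] by (simp add: abs_square_less_1 abs_less_iff)

lemma r0_eqI:
  assumes "-1 < r" "r < 1" "l * (1 - r\<^sup>2) = r"
  shows "r0 l = r"
proof -
  have "r\<^sup>2 < 1" using assms by (simp add: abs_square_less_1 abs_less_iff)
  then have "deriv (h l) r = 0"
    using DERIV_imp_deriv[OF h_has_derivative[OF assms(1,2), of l]] assms(3) by (simp add: field_simps)
  then show ?thesis unfolding r0_def using assms by (intro the1_equality[OF r0_unique]) auto
qed

text \<open>The root of the quadratic l (1 - r^2) = r in rationalised form, which stays valid at l =
  0. It supplies the continuity that the inverse function rule for \<open>r0\<close>
  requires.\<close>

lemma r0_formula: "r0 l = 2 * l / (1 + sqrt (1 + 4 * l\<^sup>2))"
proof -
  define s where "s = sqrt (1 + 4 * l\<^sup>2)"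
  have s: "s \<ge> 1" "s\<^sup>2 = 1 + 4 * l\<^sup>2" by (auto simp: s_def)
  have "(2 * l)\<^sup>2 \<le> s\<^sup>2" by (simp add: s power_mult_distrib)
  then have "\<bar>2 * l\<bar> \<le> s" using s by (metis abs_le_square_iff abs_of_nonneg order_trans zero_le_one)
  then have b: "-1 < 2 * l / (1 + s)" "2 * l / (1 + s) < 1" using s by (auto simp: field_simps abs_le_iff)
  have "(1 + s)\<^sup>2 - (2 * l)\<^sup>2 = 2 * (1 + s)" using s by (simp add: power2_eq_square algebra_simps)
  then have "1 - (2 * l / (1 + s))\<^sup>2 = 2 * (1 + s) / (1 + s)\<^sup>2"
    using s by (simp add: power_divide diff_divide_eq_iff)
  also have "\<dots> = 2 / (1 + s)" using s by (simp add: power2_eq_square del: distrib_left_numeral)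
  finally have "l * (1 - (2 * l / (1 + s))\<^sup>2) = 2 * l / (1 + s)" by simp
  then show ?thesis using r0_eqI[OF b] by (simp add: s_def)
qed

lemma isCont_r0: "isCont r0 l"
proof -
  have "sqrt (1 + 4 * l\<^sup>2) \<ge> 1" by simp
  then have "1 + sqrt (1 + 4 * l\<^sup>2) \<noteq> 0" by linarith
  then show ?thesis unfolding r0_formula[abs_def] by (intro continuous_intros)
qed

text \<open>The stationarity equation says that \<open>r0\<close> is a right inverse of r / (1 -
  r^2), whose derivative is (1 + r^2) / (1 - r^2)^2.\<close>

lemma has_derivative_r0:
  "(r0 has_real_derivative (1 - (r0 l)\<^sup>2)\<^sup>2 / (1 + (r0 l)\<^sup>2)) (at l)"
proof -
  have sq: "1 - (r0 x)\<^sup>2 > 0" for x using r0_square_less_1 by simp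
  have "((\<lambda>r. r / (1 - r\<^sup>2)) has_real_derivative (1 + (r0 l)\<^sup>2) / (1 - (r0 l)\<^sup>2)\<^sup>2) (at (r0 l))"
    using sq[of l] by (auto intro!: derivative_eq_intros simp: power2_eq_square)
  then have "(r0 has_real_derivative inverse ((1 + (r0 l)\<^sup>2) / (1 - (r0 l)\<^sup>2)\<^sup>2)) (at l)"
  proof (rule DERIV_inverse_function[where a = "l - 1" and b = "l + 1"])
    show "(1 + (r0 l)\<^sup>2) / (1 - (r0 l)\<^sup>2)\<^sup>2 \<noteq> 0"
      using sq[of l] by (simp add: add_nonneg_eq_0_iff)
    show "r0 y / (1 - (r0 y)\<^sup>2) = y" for y
      using sq[of y] r0_properties(3)[of y] by (simp add: field_simps)
  qed (auto intro: isCont_r0)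
  then show ?thesis by simp
qed

lemma has_derivative_L: "(L has_real_derivative r0 l) (at l)"
proof -
  define d where "d = (1 - (r0 l)\<^sup>2)\<^sup>2 / (1 + (r0 l)\<^sup>2)"
  have sq: "1 - (r0 l)\<^sup>2 > 0" using r0_square_less_1 by simp
  have r0d: "(r0 has_real_derivative d) (at l)" unfolding d_def by (rule has_derivative_r0)
  have "((\<lambda>l. ln (1 - (r0 l)\<^sup>2)) has_real_derivative - (2 * r0 l * d) / (1 - (r0 l)\<^sup>2)) (at l)"
    using sq by (auto intro!: derivative_eq_intros r0d)
  then have "((\<lambda>l. l * r0 l + 1/2 * ln (1 - (r0 l)\<^sup>2)) has_real_derivative
    (l * d + 1 * r0 l) + 1/2 * (- (2 * r0 l * d) / (1 - (r0 l)\<^sup>2))) (at l)"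
    by (intro DERIV_add DERIV_mult' DERIV_cmult DERIV_ident r0d)
  also have "(l * d + 1 * r0 l) + 1/2 * (- (2 * r0 l * d) / (1 - (r0 l)\<^sup>2)) =
     r0 l + d * (l - r0 l / (1 - (r0 l)\<^sup>2))"
    by (simp add: algebra_simps)
  \<comment> \<open>Envelope argument: the derivative of \<open>r0\<close> is multiplied by the
    derivative of \<open>h\<close> in r, which vanishes at the stationary point.\<close>
  also have "l - r0 l / (1 - (r0 l)\<^sup>2) = 0" using sq r0_properties(3)[of l] by (simp add: field_simps)
  finally show ?thesis by (simp add: L_def[abs_def] h_def)
qed

lemma deriv_L: "deriv L = r0"
  by (rule ext) (rule DERIV_imp_deriv[OF has_derivative_L])

lemma r0_eq_iff:
  assumes "-1 < c" "c < 1"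
  shows "r0 l = c \<longleftrightarrow> l = c / (1 - c\<^sup>2)"
proof -
  have "c\<^sup>2 < 1" using assms by (simp add: abs_square_less_1 abs_less_iff)
  then have "l * (1 - c\<^sup>2) = c \<longleftrightarrow> l = c / (1 - c\<^sup>2)" by (simp add: field_simps)
  then show ?thesis using r0_eqI[OF assms] r0_properties(3)[of l] by blast
qed

text \<open>The stationary point is a global maximum: after ln x \<le> x - 1 for the quotient of the
  two arguments, and with l = q / (1 - q^2), the upper bound for the difference is minus a square
  over 2 (1 - q^2).\<close>

lemma h_le_L:
  assumes "-1 < r" "r < 1"
  shows "h l r \<le> L l"
proof -
  define q where "q = r0 l"
  have q: "1 - q\<^sup>2 > 0" using r0_square_less_1 by (simp add: q_def)
  have r: "1 - r\<^sup>2 > 0" using assms by (simp add: abs_square_less_1 abs_less_iff)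
  have l: "l = q / (1 - q\<^sup>2)" using r0_eq_iff[OF r0_properties(1,2), of l l] by (simp add: q_def)
  have "ln (1 - r\<^sup>2) - ln (1 - q\<^sup>2) = ln ((1 - r\<^sup>2) / (1 - q\<^sup>2))"
    using q r by (simp add: ln_div)
  also have "\<dots> \<le> (1 - r\<^sup>2) / (1 - q\<^sup>2) - 1"
    using q r by (intro ln_le_minus_one) auto
  finally have "1/2 * (ln (1 - r\<^sup>2) - ln (1 - q\<^sup>2)) \<le> 1/2 * ((1 - r\<^sup>2) / (1 - q\<^sup>2) - 1)"
    by (intro mult_left_mono) auto
  moreover have "h l r - h l q = l * (r - q) + 1/2 * (ln (1 - r\<^sup>2) - ln (1 - q\<^sup>2))"
    by (simp add: h_def algebra_simps)
  ultimately have "h l r - h l q \<le> l * (r - q) + 1/2 * ((1 - r\<^sup>2) / (1 - q\<^sup>2) - 1)"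
    by linarith
  also have "\<dots> = - ((r - q)\<^sup>2 / (2 * (1 - q\<^sup>2)))"
  proof -
    define E where "E = 1 - q\<^sup>2"
    have "E > 0" using q by (simp add: E_def)
    then have "(1 - r\<^sup>2) / E - 1 = (1 - r\<^sup>2 - E) / E" by (simp add: diff_divide_distrib)
    also have "1 - r\<^sup>2 - E = q\<^sup>2 - r\<^sup>2" by (simp add: E_def)
    finally have E': "(1 - r\<^sup>2) / E - 1 = (q\<^sup>2 - r\<^sup>2) / E" .
    show ?thesis
      unfolding l E_def[symmetric] E' using \<open>E > 0\<close> by (simp add: field_simps power2_eq_square)
  qed
  also have "\<dots> \<le> 0" using q by simp
  finally show ?thesis by (simp add: L_def q_def)
qed

text \<open>The upper bound is \<open>h l y \<le> L l\<close> rearranged; it is attained at the l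
  whose stationary point is y.\<close>

lemma Lstar_eq:
  assumes "-1 < y" "y < 1"
  shows "Lstar y = ereal (- (1/2) * ln (1 - y\<^sup>2))"
  unfolding Lstar_def
proof (rule antisym)
  show "(SUP l. ereal (l * y - L l)) \<le> ereal (- (1/2) * ln (1 - y\<^sup>2))"
    using h_le_L[OF assms] by (intro SUP_least) (simp add: h_def algebra_simps)
  define l where "l = y / (1 - y\<^sup>2)"
  have "r0 l = y" using r0_eq_iff[OF assms] by (simp add: l_def)
  then have "ereal (- (1/2) * ln (1 - y\<^sup>2)) = ereal (l * y - L l)" by (simp add: L_def h_def)
  also have "\<dots> \<le> (SUP l. ereal (l * y - L l))" by (rule SUP_upper) simp
  finally show "ereal (- (1/2) * ln (1 - y\<^sup>2)) \<le> (SUP l. ereal (l * y - L l))" .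
qed

section \<open>Law and asymptotics of the correlation coefficient\<close>

lemma two_step_recursion_unique:
  fixes a b :: "nat \<Rightarrow> real"
  assumes "a 0 = b 0" "a 1 = b 1"
    and "\<And>k. real (k + 1) * a k = real (n + k) * a (k + 2)"
    and "\<And>k. real (k + 1) * b k = real (n + k) * b (k + 2)" and "n \<ge> 1"
  shows "a k = b k"
proof (induction k rule: induct_nat_012)
  case (ge2 k)
  have "real (n + k) * a (k + 2) = real (n + k) * b (k + 2)"
    unfolding assms(3,4)[symmetric] ge2 ..
  then show ?case using \<open>n \<ge> 1\<close> by simp
qed (use assms in simp_all)

text \<open>For \<open>m = n - 3\<close> this is the law of one coordinate of a uniform point on the
  unit sphere of R^n.\<close>

definition semicircle_measure :: "nat \<Rightarrow> real measure" where
  "semicircle_measure m =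
     density lborel (\<lambda>r. ennreal (indicator {-1..1} r * sqrt (1 - r\<^sup>2) ^ m / semicircle_mass m))"

lemma semicircle_density_nonneg: "0 \<le> indicator {-1..1} r * sqrt (1 - r\<^sup>2) ^ m / semicircle_mass m"
  using semicircle_mass_pos[of m]
  by (auto simp: indicator_def abs_square_le_1 abs_le_iff intro!: divide_nonneg_pos mult_nonneg_nonneg)

text \<open>Passage from Bochner integrals against the density to the gauge integrals in which
  moments and mass are defined.\<close>

lemma semicircle_density_integral:
  assumes "continuous_on {-1..1} f"
  shows "integrable lborel (\<lambda>r. indicator {-1..1} r * sqrt (1 - r\<^sup>2) ^ m / semicircle_mass m * f r)" (is ?th1)
    and "(\<integral>r. indicator {-1..1} r * sqrt (1 - r\<^sup>2) ^ m / semicircle_mass m * f r \<partial>lborel) =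
     integral {-1..1} (\<lambda>r. f r * sqrt (1 - r\<^sup>2) ^ m) / semicircle_mass m" (is ?th2)
proof -
  have c: "continuous_on {-1..1} (\<lambda>r. f r * sqrt (1 - r\<^sup>2) ^ m)"
    by (intro continuous_intros assms)
  have eq: "indicator {-1..1} r * sqrt (1 - r\<^sup>2) ^ m / semicircle_mass m * f r =
    (indicator {-1..1} r *\<^sub>R (f r * sqrt (1 - r\<^sup>2) ^ m)) / semicircle_mass m" for r
    by simp
  have i: "set_integrable lborel {-1..1} (\<lambda>r. f r * sqrt (1 - r\<^sup>2) ^ m)"
    by (rule borel_integrable_atLeastAtMost'[OF c])
  show ?th1 unfolding eq using i unfolding set_integrable_def by (rule integrable_divide)
  show ?th2 unfolding eq integral_divide_zero set_borel_integral_eq_integral(2)[OF i, symmetric]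
    set_lebesgue_integral_def ..
qed

lemma real_distribution_semicircle: "real_distribution (semicircle_measure m)"
proof -
  have "emeasure (semicircle_measure m) UNIV =
    (\<integral>\<^sup>+r. ennreal (indicator {-1..1} r * sqrt (1 - r\<^sup>2) ^ m / semicircle_mass m) \<partial>lborel)"
    unfolding semicircle_measure_def by (subst emeasure_density) auto
  also have "\<dots> = ennreal (\<integral>r. indicator {-1..1} r * sqrt (1 - r\<^sup>2) ^ m / semicircle_mass m * 1 \<partial>lborel)"
    using semicircle_density_integral(1)[of "\<lambda>_. 1" m] semicircle_density_nonneg
    by (subst nn_integral_eq_integral) auto
  also have "\<dots> = 1"
    unfolding semicircle_density_integral(2)[OF continuous_on_const]
    using semicircle_mass_pos[of m] by (simp add: semicircle_mass_def)
  finally have "prob_space (semicircle_measure m)"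
    by (intro prob_spaceI) (simp add: semicircle_measure_def)
  then show ?thesis
    by (intro real_distribution.intro real_distribution_axioms.intro) (simp_all add: semicircle_measure_def)
qed

lemma AE_semicircle: "AE r in semicircle_measure m. \<bar>r\<bar> \<le> 1"
  unfolding semicircle_measure_def
  by (subst AE_density) (auto simp: indicator_def abs_le_iff)

lemma semicircle_measure_moment: "(\<integral>r. r ^ k \<partial>semicircle_measure m) = semicircle_moment m k / semicircle_mass m"
proof -
  have "(\<integral>r. r ^ k \<partial>semicircle_measure m) =
    (\<integral>r. indicator {-1..1} r * sqrt (1 - r\<^sup>2) ^ m / semicircle_mass m * r ^ k \<partial>lborel)"
    unfolding semicircle_measure_def by (subst integral_density) (auto simp: semicircle_density_nonneg)
  also have "\<dots> = semicircle_moment m k / semicircle_mass m"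
    unfolding semicircle_moment_def by (intro semicircle_density_integral(2) continuous_intros)
  finally show ?thesis .
qed

lemma semicircle_measure_tail:
  assumes "-1 < c" "c < 1"
  shows "measure (semicircle_measure m) {c..} = semicircle_tail m c / semicircle_mass m"
proof -
  interpret real_distribution "semicircle_measure m" by (rule real_distribution_semicircle)
  have i: "set_integrable lborel {c..1} (\<lambda>r. sqrt (1 - r\<^sup>2) ^ m)"
    by (intro borel_integrable_atLeastAtMost' continuous_intros)
  have "measure (semicircle_measure m) {c..} = (\<integral>r. indicator {c..} r \<partial>semicircle_measure m)"
    by simp
  also have "\<dots> = (\<integral>r. indicator {-1..1} r * sqrt (1 - r\<^sup>2) ^ m / semicircle_mass m * indicator {c..} r \<partial>lborel)"
    unfolding semicircle_measure_def by (subst integral_density) (auto simp: semicircle_density_nonneg)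
  also have "\<dots> = (\<integral>r. (indicator {c..1} r *\<^sub>R sqrt (1 - r\<^sup>2) ^ m) / semicircle_mass m \<partial>lborel)"
    by (intro Bochner_Integration.integral_cong refl) (use assms in \<open>auto simp: indicator_def\<close>)
  also have "\<dots> = semicircle_tail m c / semicircle_mass m"
    unfolding integral_divide_zero semicircle_tail_def set_borel_integral_eq_integral(2)[OF i, symmetric]
      set_lebesgue_integral_def ..
  finally show ?thesis .
qed

lemma spherical_coord_law:
  fixes \<mu> :: "(nat \<Rightarrow> real) measure"
  assumes n: "n = m + 3" and prob: "prob_space \<mu>" and sph: "spherical n \<mu>" and sets: "sets \<mu> = sets (Rn n)"
    and nz: "AE x in \<mu>. dot n x x \<noteq> 0"
  shows "distr \<mu> borel (\<lambda>x. x 1 / sqrt (dot n x x)) = semicircle_measure m"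
proof (rule real_distribution_moments_unique)
  interpret prob_space \<mu> by fact
  have n1: "n \<ge> 1" and i: "(1::nat) \<in> {1..n}" using n by auto
  note ctx = n1 prob sph sets nz
  have u: "unit_coord n 1 = (\<lambda>x. x 1 / sqrt (dot n x x))"
    using ctx by (simp add: fun_eq_iff unit_coord_def)
  have meas[measurable]: "unit_coord n 1 \<in> borel_measurable \<mu>"
    using measurable_unit_coord[OF ctx i] .
  show "real_distribution (distr \<mu> borel (\<lambda>x. x 1 / sqrt (dot n x x)))"
    unfolding u[symmetric] by (rule real_distribution_distr) (rule meas)
  show "AE x in distr \<mu> borel (\<lambda>x. x 1 / sqrt (dot n x x)). \<bar>x\<bar> \<le> 1"
    unfolding u[symmetric] using abs_unit_coord_le[OF ctx i] by (subst AE_distr_iff[OF meas]) auto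
  fix k
  have mom: "(\<integral>y. y ^ j \<partial>distr \<mu> borel (\<lambda>x. x 1 / sqrt (dot n x x))) = (\<integral>x. unit_coord n 1 x ^ j \<partial>\<mu>)" for j
    unfolding u[symmetric] by (subst integral_distr[OF meas]) auto
  show "(\<integral>y. y ^ k \<partial>distr \<mu> borel (\<lambda>x. x 1 / sqrt (dot n x x))) = (\<integral>r. r ^ k \<partial>semicircle_measure m)"
    unfolding mom semicircle_measure_moment
  proof (rule two_step_recursion_unique[where a = "\<lambda>j. \<integral>x. unit_coord n 1 x ^ j \<partial>\<mu>"
        and b = "\<lambda>j. semicircle_moment m j / semicircle_mass m", OF _ _ _ _ n1])
    show "(\<integral>x. unit_coord n 1 x ^ 0 \<partial>\<mu>) = semicircle_moment m 0 / semicircle_mass m"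
      using semicircle_mass_pos[of m] prob_space by (simp add: semicircle_mass_moment)
    show "(\<integral>x. unit_coord n 1 x ^ 1 \<partial>\<mu>) = semicircle_moment m 1 / semicircle_mass m"
      using unit_coord_odd_moment[OF ctx i, of 1] by (simp add: semicircle_moment_1[simplified])
    show "real (j + 1) * (\<integral>x. unit_coord n 1 x ^ j \<partial>\<mu>) = real (n + j) * (\<integral>x. unit_coord n 1 x ^ (j + 2) \<partial>\<mu>)" for j
      using unit_coord_moment_rec[OF ctx i] .
    show "real (j + 1) * (semicircle_moment m j / semicircle_mass m) =
      real (n + j) * (semicircle_moment m (j + 2) / semicircle_mass m)" for j
      using semicircle_moment_rec[of j m] by (simp add: n add_ac)
  qed
qed (use real_distribution_semicircle AE_semicircle in auto)

text \<open>After normalising \<open>v\<close> to length 1, rotation invariance replaces it by the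
  first unit vector, so the probability is the same for all nonzero \<open>v\<close>.\<close>

lemma spherical_cap_prob:
  fixes \<mu> :: "(nat \<Rightarrow> real) measure"
  assumes n: "n = m + 3" and prob: "prob_space \<mu>" and sph: "spherical n \<mu>" and sets: "sets \<mu> = sets (Rn n)"
    and nz: "AE x in \<mu>. dot n x x \<noteq> 0" and v: "dot n v v \<noteq> 0" and c: "-1 < c" "c < 1"
  shows "emeasure \<mu> {x \<in> space \<mu>. c \<le> dot n x v / sqrt (dot n x x * dot n v v)} =
    ennreal (semicircle_tail m c / semicircle_mass m)"
proof -
  interpret prob_space \<mu> by fact
  have [measurable_cong]: "sets \<mu> = sets (Rn n)" by fact
  define e where "e = (\<lambda>k::nat. if k = 1 then 1 else (0::real))"
  define u where "u = (\<lambda>i. 1 / sqrt (dot n v v) * v i)"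
  have e: "dot n x e = x 1" for x using dot_single[of 1 n x] n by (simp add: e_def)
  have u: "dot n x u = dot n x v / sqrt (dot n v v)" for x
    unfolding u_def dot_scale_right by simp
  have "dot n u u = dot n u v / sqrt (dot n v v)" by (rule u)
  also have "\<dots> = dot n v v / sqrt (dot n v v) / sqrt (dot n v v)"
    unfolding dot_commute[of n u v] u ..
  also have "\<dots> = 1" using v dot_nonneg[of n v] by (simp add: real_div_sqrt)
  finally have "dot n u u = dot n e e" by (simp add: e) (simp add: e_def)
  from spherical_distr_cosine_eq[OF sph sets this]
  have law: "distr \<mu> borel (\<lambda>x. dot n x v / sqrt (dot n x x * dot n v v)) = semicircle_measure m"
    unfolding e u using spherical_coord_law[OF n prob sph sets nz]
    by (simp add: real_sqrt_mult mult.commute)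
  interpret S: real_distribution "semicircle_measure m" by (rule real_distribution_semicircle)
  have meas: "(\<lambda>x. dot n x v / sqrt (dot n x x * dot n v v)) \<in> borel_measurable \<mu>"
    unfolding measurable_cong_sets[OF sets refl] by measurable
  have "emeasure \<mu> {x \<in> space \<mu>. c \<le> dot n x v / sqrt (dot n x x * dot n v v)} =
    emeasure (distr \<mu> borel (\<lambda>x. dot n x v / sqrt (dot n x x * dot n v v))) {c..}"
    by (subst emeasure_distr[OF meas]) (auto intro!: arg_cong[where f = "emeasure \<mu>"])
  also have "\<dots> = ennreal (semicircle_tail m c / semicircle_mass m)"
    unfolding law S.emeasure_eq_measure semicircle_measure_tail[OF c] ..
  finally show ?thesis .
qed

lemma spherical_mean_zero:
  assumes sph: "spherical n \<mu>" and sets: "sets \<mu> = sets (Rn n)" and i: "i \<in> {1..n}"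
  shows "(\<integral>x. x i \<partial>\<mu>) = (0::real)"
proof -
  \<comment> \<open>Minus the identity is orthogonal, so the mean equals its own negative.\<close>
  define A :: "nat \<Rightarrow> nat \<Rightarrow> real" where "A = (\<lambda>i j. if i = j then -1 else 0)"
  have "orthogonal_mat n A"
    unfolding orthogonal_mat_def A_def by (auto simp: if_distrib[of "\<lambda>x. x * _"] if_distrib[of uminus] cong: if_cong)
  then have inv: "distr \<mu> (Rn n) (mat_apply n A) = \<mu>" using sph by (auto simp: spherical_def)
  have meas: "mat_apply n A \<in> measurable \<mu> (Rn n)"
    unfolding measurable_cong_sets[OF sets refl] by (rule measurable_mat_apply)
  have "(\<integral>x. x i \<partial>\<mu>) = (\<integral>x. x i \<partial>distr \<mu> (Rn n) (mat_apply n A))" by (simp only: inv)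
  also have "\<dots> = (\<integral>x. mat_apply n A x i \<partial>\<mu>)"
    by (rule integral_distr[OF meas measurable_component_Rn[OF i]])
  also have "\<dots> = (\<integral>x. - x i \<partial>\<mu>)"
    using i by (intro Bochner_Integration.integral_cong refl)
      (simp add: mat_apply_def A_def if_distrib[of "\<lambda>x. x * _"] cong: if_cong)
  finally show ?thesis by simp
qed

lemma pearson_tail_prob:
  fixes M :: "'a measure" and X Y :: "'a \<Rightarrow> nat \<Rightarrow> real"
  assumes n: "n = m + 3" and M: "prob_space M"
    and X: "X \<in> measurable M (Rn n)" and Y: "Y \<in> measurable M (Rn n)"
    and ind: "prob_space.indep_var M (Rn n) X (Rn n) Y"
    and sph: "spherical n (distr M (Rn n) X)"
    and X0: "\<P>(w in M. \<forall>i\<in>{1..n}. X w i = 0) = 0"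
    and Y0: "\<P>(w in M. \<forall>i\<in>{1..n}. Y w i = mean M Y i) = 0"
    and c: "-1 < c" "c < 1"
  shows "\<P>(w in M. pearson_known_means M n X Y w \<ge> c) = semicircle_tail m c / semicircle_mass m"
proof -
  interpret prob_space M by (rule M)
  note [measurable] = X Y
  define \<mu> where "\<mu> = distr M (Rn n) X"
  define \<nu> where "\<nu> = distr M (Rn n) Y"
  have sets_\<mu>[measurable_cong]: "sets \<mu> = sets (Rn n)" and sets_\<nu>[measurable_cong]: "sets \<nu> = sets (Rn n)"
    by (simp_all add: \<mu>_def \<nu>_def)
  interpret \<mu>: prob_space \<mu> unfolding \<mu>_def by (rule prob_space_distr) fact
  interpret \<nu>: prob_space \<nu> unfolding \<nu>_def by (rule prob_space_distr) fact
  interpret pair_sigma_finite \<mu> \<nu> ..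
  have sph\<mu>: "spherical n \<mu>" using sph by (simp add: \<mu>_def)
  define b where "b = mean M Y"
  define z where "z = (\<lambda>y i. y i - b i)"
  have dz: "dot n x (z y) = dot n x y - dot n x b" for x y
    unfolding z_def by (rule dot_diff_right)
  have mean_X: "mean M X i = 0" if "i \<in> {1..n}" for i
  proof -
    have "mean M X i = (\<integral>x. x i \<partial>\<mu>)"
      unfolding mean_def \<mu>_def by (rule integral_distr[OF X measurable_component_Rn[OF that], symmetric])
    then show ?thesis using spherical_mean_zero[OF sph\<mu> sets_\<mu> that] by simp
  qed
  have pearson: "pearson_known_means M n X Y w = dot n (X w) (z (Y w)) / sqrt (dot n (X w) (X w) * dot n (z (Y w)) (z (Y w)))" for w
    unfolding pearson_known_means_def dot_def z_def b_def using mean_X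
    by (simp add: power2_eq_square)
  \<comment> \<open>The centred vector \<open>z y\<close> need not be extensional and so need not
    lie in the space of \<open>Rn n\<close>. Expanding in \<open>y\<close> and the constant
    \<open>b\<close> gives expressions to which the measurability rules apply.\<close>
  have zz: "dot n (z y) (z y) = dot n y y - 2 * dot n y b + dot n b b" for y
    unfolding dz dot_commute[of n "z y"] by (simp add: dot_commute)
  have nzX: "AE x in \<mu>. dot n x x \<noteq> 0"
  proof -
    have "AE w in M. dot n (X w) (X w) \<noteq> 0"
    proof (rule AE_I)
      show "{w \<in> space M. \<not> dot n (X w) (X w) \<noteq> 0} \<subseteq> {w \<in> space M. dot n (X w) (X w) = 0}" by auto
      show "emeasure M {w \<in> space M. dot n (X w) (X w) = 0} = 0"
        using X0 by (simp add: dot_eq_0_iff emeasure_eq_measure)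
    qed measurable
    moreover have "{x \<in> space (Rn n). dot n x x \<noteq> 0} \<in> sets (Rn n)" by measurable
    ultimately show ?thesis unfolding \<mu>_def by (subst AE_distr_iff[OF X])
  qed
  \<comment> \<open>Where the centred \<open>Y\<close> vanishes, the quotient 0/0 evaluates to 0 for
    every value of \<open>X\<close>, and the cap probability does not apply.\<close>
  have nzY: "AE y in \<nu>. dot n (z y) (z y) \<noteq> 0"
  proof -
    have "AE w in M. dot n (z (Y w)) (z (Y w)) \<noteq> 0"
    proof (rule AE_I)
      show "{w \<in> space M. \<not> dot n (z (Y w)) (z (Y w)) \<noteq> 0} \<subseteq> {w \<in> space M. dot n (z (Y w)) (z (Y w)) = 0}" by auto
      show "emeasure M {w \<in> space M. dot n (z (Y w)) (z (Y w)) = 0} = 0"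
        using Y0 by (simp add: dot_eq_0_iff emeasure_eq_measure z_def b_def)
      show "{w \<in> space M. dot n (z (Y w)) (z (Y w)) = 0} \<in> sets M"
        unfolding zz by measurable
    qed
    moreover have "{y \<in> space (Rn n). dot n (z y) (z y) \<noteq> 0} \<in> sets (Rn n)"
      unfolding zz by measurable
    ultimately show ?thesis unfolding \<nu>_def by (subst AE_distr_iff[OF Y])
  qed
  define S where "S = {p \<in> space (Rn n \<Otimes>\<^sub>M Rn n).
    c \<le> dot n (fst p) (z (snd p)) / sqrt (dot n (fst p) (fst p) * dot n (z (snd p)) (z (snd p)))}"
  have S[measurable]: "S \<in> sets (Rn n \<Otimes>\<^sub>M Rn n)"
  proof -
    have [measurable]: "(\<lambda>p. dot n (fst p) (z (snd p))) \<in> borel_measurable (Rn n \<Otimes>\<^sub>M Rn n)"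
      unfolding dz
      by (intro borel_measurable_diff measurable_dot_Rn measurable_fst measurable_snd
          measurable_compose[OF measurable_fst measurable_dot_const])
    have [measurable]: "(\<lambda>p. dot n (fst p) (fst p)) \<in> borel_measurable (Rn n \<Otimes>\<^sub>M Rn n)"
      by (intro measurable_dot_Rn measurable_fst)
    have "(\<lambda>y. dot n (z y) (z y)) \<in> borel_measurable (Rn n)"
      unfolding zz by measurable
    from measurable_compose[OF measurable_snd this]
    have [measurable]: "(\<lambda>p. dot n (z (snd p)) (z (snd p))) \<in> borel_measurable (Rn n \<Otimes>\<^sub>M Rn n)" .
    show ?thesis unfolding S_def
      by (intro borel_measurable_pred_less borel_measurable_le borel_measurable_const borel_measurable_divide
          measurable_compose[OF _ borel_measurable_sqrt] borel_measurable_times) fact+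
  qed
  have sp: "space \<mu> = space (Rn n)" "space \<nu> = space (Rn n)" by (simp_all add: \<mu>_def \<nu>_def)
  have joint: "\<mu> \<Otimes>\<^sub>M \<nu> = distr M (Rn n \<Otimes>\<^sub>M Rn n) (\<lambda>w. (X w, Y w))"
    using ind unfolding indep_var_distribution_eq \<mu>_def \<nu>_def by auto
  have "emeasure M {w \<in> space M. pearson_known_means M n X Y w \<ge> c} = emeasure (\<mu> \<Otimes>\<^sub>M \<nu>) S"
    unfolding joint using measurable_space[OF X] measurable_space[OF Y]
    by (subst emeasure_distr[OF measurable_Pair[OF X Y] S])
      (auto simp: S_def pearson space_pair_measure intro!: arg_cong[where f = "emeasure M"])
  \<comment> \<open>Independence has made the joint law a product, so conditioning on
    \<open>Y\<close> amounts to slicing \<open>S\<close> at fixed y.\<close>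
  also have "\<dots> = (\<integral>\<^sup>+y. emeasure \<mu> ((\<lambda>x. (x, y)) -` S) \<partial>\<nu>)"
    by (rule emeasure_pair_measure_alt2) (simp add: sets_pair_measure_cong[OF sets_\<mu> sets_\<nu>] S)
  also have "\<dots> = (\<integral>\<^sup>+y. ennreal (semicircle_tail m c / semicircle_mass m) \<partial>\<nu>)"
  proof (rule nn_integral_cong_AE)
    have "AE y in \<nu>. y \<in> space \<nu>" by (rule AE_space)
    with nzY show "AE y in \<nu>. emeasure \<mu> ((\<lambda>x. (x, y)) -` S) = ennreal (semicircle_tail m c / semicircle_mass m)"
    proof eventually_elim
      case (elim y)
      have "(\<lambda>x. (x, y)) -` S = {x \<in> space \<mu>. c \<le> dot n x (z y) / sqrt (dot n x x * dot n (z y) (z y))}"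
        using elim(2) by (auto simp: S_def space_pair_measure sp)
      then show ?case
        using spherical_cap_prob[OF n \<mu>.prob_space_axioms sph\<mu> sets_\<mu> nzX elim(1) c] by simp
    qed
  qed
  also have "\<dots> = ennreal (semicircle_tail m c / semicircle_mass m)"
    by (simp add: \<nu>.emeasure_space_1)
  finally have *: "emeasure M {w \<in> space M. pearson_known_means M n X Y w \<ge> c} =
    ennreal (semicircle_tail m c / semicircle_mass m)" .
  have "semicircle_tail m c / semicircle_mass m \<ge> 0"
    unfolding semicircle_measure_tail[OF c, symmetric] by simp
  then show ?thesis using * by (simp add: measure_def)
qed


text \<open>Quotient of the tail asymptotics by those of the mass. The index \<open>m + 3\<close> is
  the dimension n; exchanging (m + 2) / sqrt m for sqrt (m + 3) costs a factor tending to 1.\<close>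

lemma cap_prob_asymp:
  assumes c: "0 < c" "c < 1"
  shows "(\<lambda>m. semicircle_tail m c / semicircle_mass m /
    (sqrt (1 - c\<^sup>2) ^ (m + 2) / (c * sqrt (2 * pi * real (m + 3))))) \<longlonglongrightarrow> 1"
proof -
  have "c\<^sup>2 < 1" using c by (simp add: abs_square_less_1 abs_less_iff)
  then have s: "sqrt (1 - c\<^sup>2) > 0" by simp
  have "(\<lambda>m. sqrt (real m) * sqrt (real (m + 3)) / real (m + 2)) \<longlonglongrightarrow> 1"
    by real_asymp
  then have "(\<lambda>m. semicircle_tail m c / (sqrt (1 - c\<^sup>2) ^ (m + 2) / (c * real (m + 2))) *
    (sqrt (2 * pi) / (sqrt (real m) * semicircle_mass m)) *
    (sqrt (real m) * sqrt (real (m + 3)) / real (m + 2))) \<longlonglongrightarrow> 1 * (sqrt (2 * pi) / sqrt (2 * pi)) * 1"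
    by (intro tendsto_mult tendsto_divide tendsto_const semicircle_tail_asymp[OF c] semicircle_mass_asymp) auto
  then have "(\<lambda>m. semicircle_tail m c / (sqrt (1 - c\<^sup>2) ^ (m + 2) / (c * real (m + 2))) *
    (sqrt (2 * pi) / (sqrt (real m) * semicircle_mass m)) *
    (sqrt (real m) * sqrt (real (m + 3)) / real (m + 2))) \<longlonglongrightarrow> 1"
    by simp
  then show ?thesis
  proof (rule Lim_transform_eventually)
    have alg: "T / (q / (c * a)) * (p / (x * W)) * (x * y / a) = T / W / (q / (c * (p * y)))"
      if "q > 0" "a > 0" "x > 0" "W > 0" "p > 0" "y > 0" for T q a p x W y :: real
      using that c by (simp add: field_simps)
    show "\<forall>\<^sub>F m in sequentially. semicircle_tail m c / (sqrt (1 - c\<^sup>2) ^ (m + 2) / (c * real (m + 2))) *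
        (sqrt (2 * pi) / (sqrt (real m) * semicircle_mass m)) *
        (sqrt (real m) * sqrt (real (m + 3)) / real (m + 2)) =
      semicircle_tail m c / semicircle_mass m /
        (sqrt (1 - c\<^sup>2) ^ (m + 2) / (c * sqrt (2 * pi * real (m + 3))))"
      using eventually_gt_at_top[of 0]
    proof eventually_elim
      case (elim m)
      show ?case unfolding real_sqrt_mult[of "2 * pi"]
        by (rule alg) (use elim s semicircle_mass_pos[of m] in auto)
    qed
  qed
qed

text \<open>An exact identity for every \<open>m\<close>. In the exponent ln d collects the
  coefficient (n + 1 - 2) / 2 = (m + 2) / 2, and the remaining 1 / sqrt e cancels against lam * sig
  = c / sqrt e.\<close>

lemma saddlepoint_expression:
  assumes c: "0 < c" "c < 1" and lam: "lam = c / (1 - c\<^sup>2)"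
    and sig: "sig > 0" "sig\<^sup>2 = (1 - c\<^sup>2)\<^sup>2 / (1 + c\<^sup>2)"
  shows "exp (- real (m + 3) * (- (1/2) * ln (1 - c\<^sup>2)) - 1/4 * ln (1 + 4 * lam\<^sup>2)
      + ln ((1 + sqrt (1 + 4 * lam\<^sup>2)) / 2)) / (lam * sig * sqrt (2 * pi * real (m + 3)))
    = sqrt (1 - c\<^sup>2) ^ (m + 2) / (c * sqrt (2 * pi * real (m + 3)))"
proof -
  define d where "d = 1 - c\<^sup>2"
  define e where "e = 1 + c\<^sup>2"
  have "c\<^sup>2 < 1" using c by (simp add: abs_square_less_1 abs_less_iff)
  then have d: "d > 0" and e: "e > 0" by (auto simp: d_def e_def intro: add_pos_nonneg)
  have de: "d + e = 2" and ed: "e\<^sup>2 = d\<^sup>2 + 4 * c\<^sup>2" by (simp_all add: d_def e_def power2_eq_square algebra_simps)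
  have "1 + 4 * lam\<^sup>2 = (e / d)\<^sup>2"
    using d unfolding lam d_def[symmetric] power_divide ed by (simp add: field_simps)
  moreover have "ln ((e / d)\<^sup>2) = 2 * (ln e - ln d)"
    using d e by (simp add: ln_realpow ln_div)
  ultimately have l1: "ln (1 + 4 * lam\<^sup>2) = 2 * (ln e - ln d)" and l2: "sqrt (1 + 4 * lam\<^sup>2) = e / d"
    using d e by simp_all
  have "(1 + e / d) / 2 = 1 / d" using d de by (simp add: field_simps)
  then have l3: "ln ((1 + sqrt (1 + 4 * lam\<^sup>2)) / 2) = - ln d"
    using d unfolding l2 by (simp add: ln_div)
  have "sig = sqrt (sig\<^sup>2)" using sig(1) by simp
  also have "\<dots> = d / sqrt e" unfolding sig d_def[symmetric] e_def[symmetric] using d by (simp add: real_sqrt_divide)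
  finally have ls: "lam * sig = c / sqrt e" using d unfolding lam d_def[symmetric] by simp
  have sqd: "exp (ln d / 2) = sqrt d" and sqe: "exp (ln e / 2) = sqrt e"
    using d e by (simp_all add: ln_sqrt[symmetric])
  have "exp (- real (m + 3) * (- (1/2) * ln d) - 1/4 * (2 * (ln e - ln d)) + - ln d)
    = exp (real (m + 2) * (ln d / 2) - ln e / 2)"
    by (rule arg_cong[where f = exp]) (simp add: field_simps)
  also have "\<dots> = sqrt d ^ (m + 2) / sqrt e"
    unfolding exp_diff sqe exp_of_nat_mult sqd ..
  finally have "exp (- real (m + 3) * (- (1/2) * ln (1 - c\<^sup>2)) - 1/4 * ln (1 + 4 * lam\<^sup>2)
      + ln ((1 + sqrt (1 + 4 * lam\<^sup>2)) / 2)) = sqrt d ^ (m + 2) / sqrt e"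
    unfolding l1 l3 d_def .
  then show ?thesis
    unfolding ls d_def[symmetric] using e by simp
qed


theorem theorem2p8:
  fixes M :: "nat \<Rightarrow> 'a measure"
    and X Y :: "nat \<Rightarrow> 'a \<Rightarrow> nat \<Rightarrow> real"
    and c lambda_c sigma_c :: real
  assumes "\<And>n. n > 2 \<Longrightarrow> prob_space (M n)"
    and "\<And>n. n > 2 \<Longrightarrow> X n \<in> measurable (M n) (Rn n)"
    and "\<And>n. n > 2 \<Longrightarrow> Y n \<in> measurable (M n) (Rn n)"
    and "\<And>n. n > 2 \<Longrightarrow> prob_space.indep_var (M n) (Rn n) (X n) (Rn n) (Y n)"
    and "\<And>n. n > 2 \<Longrightarrow> spherical n (distr (M n) (Rn n) (X n))"
    and "\<And>n. n > 2 \<Longrightarrow> \<P>(w in M n. \<forall>i\<in>{1..n}. X n w i = 0) = 0"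
    and "\<And>n. n > 2 \<Longrightarrow> \<P>(w in M n. \<exists>k. \<forall>i\<in>{1..n}. Y n w i = k) = 0"
    and "\<And>n i. n > 2 \<Longrightarrow> i \<in> {1..n} \<Longrightarrow> integrable (M n) (\<lambda>w. X n w i)"
    and "\<And>n i. n > 2 \<Longrightarrow> i \<in> {1..n} \<Longrightarrow> integrable (M n) (\<lambda>w. Y n w i)"
    and Y_ne_mean: "\<And>n. n > 2 \<Longrightarrow> \<P>(w in M n. \<forall>i\<in>{1..n}. Y n w i = mean (M n) (Y n) i) = 0"
      \<comment> \<open>the correlation coefficient is almost surely defined, i.e. not of the form 0/0\<close>
    and "0 < c" "c < 1"
    and "lambda_c = c / (1 - c\<^sup>2)"
    and "sigma_c > 0" "sigma_c\<^sup>2 = (1 - c\<^sup>2)\<^sup>2 / (1 + c\<^sup>2)"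
  shows "(\<forall>l. L differentiable (at l)) \<and>
    (\<forall>l. deriv L l = c \<longleftrightarrow> l = lambda_c) \<and>
    (deriv L has_real_derivative sigma_c\<^sup>2) (at lambda_c) \<and>
    (\<forall>y. -1 < y \<and> y < 1 \<longrightarrow> Lstar y = ereal (- (1/2) * ln (1 - y\<^sup>2))) \<and>
    (\<exists>\<epsilon>. \<epsilon> \<longlonglongrightarrow> 0 \<and>
      (\<forall>n>2. \<P>(w in M n. pearson_known_means (M n) n (X n) (Y n) w \<ge> c) =
         exp (- real n * real_of_ereal (Lstar c) - 1/4 * ln (1 + 4 * lambda_c\<^sup>2)
              + ln ((1 + sqrt (1 + 4 * lambda_c\<^sup>2)) / 2))
         / (lambda_c * sigma_c * sqrt (2 * pi * real n)) * (1 + \<epsilon> n)))"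
proof -
  note M = assms(1) and X = assms(2) and Y = assms(3) and ind = assms(4) and sph = assms(5)
    and X0 = assms(6) and Y0 = assms(10)
  note c = \<open>0 < c\<close> \<open>c < 1\<close> and lam = \<open>lambda_c = c / (1 - c\<^sup>2)\<close>
    and sig = \<open>sigma_c > 0\<close> \<open>sigma_c\<^sup>2 = (1 - c\<^sup>2)\<^sup>2 / (1 + c\<^sup>2)\<close>
  have c': "-1 < c" "c < 1" using c by auto
  have r0c: "r0 lambda_c = c" using r0_eq_iff[OF c'] lam by simp
  have Lc: "real_of_ereal (Lstar c) = - (1/2) * ln (1 - c\<^sup>2)" using Lstar_eq[OF c'] by simp
  define R where "R m = sqrt (1 - c\<^sup>2) ^ (m + 2) / (c * sqrt (2 * pi * real (m + 3)))" for m
  define p where "p m = semicircle_tail m c / semicircle_mass m" for m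
  \<comment> \<open>The relative error of the closed form. Truncated subtraction alters only the
    terms with n < 3, which affect neither the limit nor the identity claimed for n > 2.\<close>
  define \<epsilon> where "\<epsilon> n = p (n - 3) / R (n - 3) - 1" for n
  have "c\<^sup>2 < 1" using c by (simp add: abs_square_less_1 abs_less_iff)
  then have R: "R m > 0" for m
    unfolding R_def using c by (intro divide_pos_pos mult_pos_pos zero_less_power) auto
  have "(\<lambda>m. p m / R m - 1) \<longlonglongrightarrow> 1 - 1"
    unfolding p_def R_def by (intro tendsto_diff tendsto_const cap_prob_asymp[OF c])
  then have "(\<lambda>m. \<epsilon> (m + 3)) \<longlonglongrightarrow> 0" by (simp add: \<epsilon>_def)
  then have lim: "\<epsilon> \<longlonglongrightarrow> 0" by (rule LIMSEQ_offset)
  have prob: "\<P>(w in M n. pearson_known_means (M n) n (X n) (Y n) w \<ge> c) =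
         exp (- real n * real_of_ereal (Lstar c) - 1/4 * ln (1 + 4 * lambda_c\<^sup>2)
              + ln ((1 + sqrt (1 + 4 * lambda_c\<^sup>2)) / 2))
         / (lambda_c * sigma_c * sqrt (2 * pi * real n)) * (1 + \<epsilon> n)" if n: "n > 2" for n
  proof -
    define m where "m = n - 3"
    have nm: "n = m + 3" using n by (simp add: m_def)
    have "\<P>(w in M n. pearson_known_means (M n) n (X n) (Y n) w \<ge> c) = p m"
      unfolding p_def
      by (rule pearson_tail_prob[OF nm M[OF n] X[OF n] Y[OF n] ind[OF n] sph[OF n] X0[OF n] Y0[OF n] c'])
    also have "\<dots> = R m * (1 + \<epsilon> n)" using R[of m] by (simp add: \<epsilon>_def m_def)
    finally show ?thesis
      unfolding Lc saddlepoint_expression[OF c lam sig, of m, folded nm] R_def nm[symmetric] .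
  qed
  have "\<forall>l. L differentiable (at l)"
    using has_derivative_L real_differentiable_def by blast
  moreover have "\<forall>l. deriv L l = c \<longleftrightarrow> l = lambda_c"
    unfolding deriv_L lam using r0_eq_iff[OF c'] by blast
  moreover have "(deriv L has_real_derivative sigma_c\<^sup>2) (at lambda_c)"
    unfolding deriv_L sig using has_derivative_r0[of lambda_c] by (simp only: r0c)
  ultimately show ?thesis
    using Lstar_eq lim prob by blast
qed

end
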